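(* For all $\mathsf{U}^\mathsf{t}\subseteq\{\neg,\mathbf{X},\mathbf{F},\mathbf{G}\}$, $\mathsf{B}^\mathsf{t}\subseteq\{\mathbf{U},\mathbf{R},\mathbf{W},\mathbf{M}\}$, $\mathsf{B}^\mathsf{l}\subseteq\mathrm{Bin}_{lg}$ and $n\in\mathbb{N}\cup\{\infty\}$, there is a logarithmic-space reduction from $\mathrm{LTL}_{\mathrm{Learn}}(\mathsf{U}^\mathsf{t},\mathsf{B}^\mathsf{t},\mathsf{B}^\mathsf{l},n)$ to $\mathrm{CTL}_{\mathrm{Learn}}(\mathsf{U}^\mathsf{t},\mathsf{B}^\mathsf{t},\mathsf{B}^\mathsf{l},n)$. Consequently, for every $k\ge1$, $\mathrm{ATL}^k_{\mathrm{Learn}}(\mathsf{U}^\mathsf{t},\mathsf{B}^\mathsf{t},\mathsf{B}^\mathsf{l},n)$ is also at least as hard as $\mathrm{LTL}_{\mathrm{Learn}}(\mathsf{U}^\mathsf{t},\mathsf{B}^\mathsf{t},\mathsf{B}^\mathsf{l},n)$ under logarithmic-space reductions.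
   Context: Operators: $\mathrm{Un}=\{\neg,\mathbf{X},\mathbf{F},\mathbf{G}\}$, $\mathrm{Bin}_{tp}=\{\mathbf{U},\mathbf{R},\mathbf{W},\mathbf{M}\}$, $\mathrm{Bin}_{lg}$ = $\{\vee,\wedge,\Rightarrow,\Leftarrow,\Leftrightarrow\}$ together with their negations ($x(\neg* )y:=\neg(x*y)$). LTL: formulas $\varphi::=p\mid\circ\varphi\mid\varphi*\varphi$ ($\circ\in\mathsf{U}^\mathsf{t}$, $*\in\mathsf{B}^\mathsf{t}\cup\mathsf{B}^\mathsf{l}$) interpreted on infinite words over $2^{\mathsf{Prop}}$ with standard semantics ($\mathbf{X}$ next, $\mathbf{F}$ eventually, $\mathbf{G}$ always, $\mathbf{U}$ until, $\varphi_1\mathbf{R}\varphi_2:=\neg(\neg\varphi_1\mathbf{U}\neg\varphi_2)$, $\varphi_1\mathbf{W}\varphi_2:=(\varphi_1\mathbf{U}\varphi_2)\vee\mathbf{G}\varphi_1$, $\varphi_1\mathbf{M}\varphi_2:=(\varphi_1\mathbf{R}\varphi_2)\wedge\mathbf{F}\varphi_1$). Concurrent game structure (CGS) with agents $\mathrm{Ag}=\{1,\dots,k\}$: $C=\langle Q,I,k,\mathsf{Prop},\pi,d,\delta\rangle$ with finite state set $Q$, initial states $I\subseteq Q$, labelling $\pi:Q\to2^{\mathsf{Prop}}$, numbers of actions $d(q,a)\ge1$, transition function $\delta(q,\alpha_1,\dots,\alpha_k)\in Q$; size $|Q_{\mathrm{Act}}|+|\mathsf{Prop}|$ where $Q_{\mathrm{Act}}$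 is the set of tuples $(q,\alpha_1,\dots,\alpha_k)$ of legal actions. A strategy for agent $a$ maps finite histories to legal actions; for a coalition $A$ and strategy profile $s$, $\mathrm{Out}(q,s)$ is the set of infinite paths from $q$ consistent with $s$ (the other agents' actions arbitrary). A Kripke structure is the case $k=1$, given by successor sets $\emptyset\ne\mathrm{Succ}(q)\subseteq Q$. $\mathrm{ATL}^k(\mathsf{Prop},\mathsf{U}^\mathsf{t},\mathsf{B}^\mathsf{t},\mathsf{B}^\mathsf{l})$: state formulas $\phi::=p\mid\neg\phi\mid\phi*\phi\ ( *\in\mathsf{B}^\mathsf{l})\mid\langle\!\langle A\rangle\!\rangle\psi$ ($A\subseteq\mathrm{Ag}$), path formulas $\psi::=\circ\phi\ (\circ\in\mathsf{U}^\mathsf{t}\setminus\{\neg\})\mid\phi*\phi\ ( *\in\mathsf{B}^\mathsf{t})$, with negation available only if $\neg\in\mathsf{U}^\mathsf{t}$; $q\models\langle\!\langle A\rangle\!\rangle\psi$ iff some strategy profile $s$ of $A$ makes every path of $\mathrm{Out}(q,s)$ satisfy $\psi$ (path operators as in LTL, evaluated on states). CTL is $\mathrm{ATL}^1$ ($\forall=\langle\!\langle\emptyset\rangle\!\rangle$, $\exists=\langle\!\langle\{1\}\rangle\!\rangle$). A structure satisfies $\phi$ iff all its initial states do. Sizes: $|\phi|$ is the number of distinct state subformulas (where $\langle\!\langle A\rangle\!\rangle(\circ\phi)$ and $\langle\!\langle A\rangle\!\rangle(\phi_1*\phi_2)$ each count as one subformula), $|\phi|_{\mathrm{Bin}}$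 the number of distinct subformulas of the form $\phi_1*\phi_2$ or $\langle\!\langle A\rangle\!\rangle(\phi_1*\phi_2)$. Learning problems (for $n\in\mathbb{N}\cup\{\infty\}$): input $(\mathsf{Prop},\mathcal{P},\mathcal{N},B)$, with $B$ in unary and $\mathcal{P},\mathcal{N}$ finite sets of models; yes iff some formula of the fragment with size $\le B$ and $|\cdot|_{\mathrm{Bin}}\le n$ accepts all models in $\mathcal{P}$ and rejects all in $\mathcal{N}$. For $\mathrm{LTL}_{\mathrm{Learn}}$ models are ultimately periodic words $u\cdot v^\omega$ (size $|u|+|v|$), for $\mathrm{CTL}_{\mathrm{Learn}}$ Kripke structures, for $\mathrm{ATL}^k_{\mathrm{Learn}}$ CGS with $k$ agents. *)

theory Defs
  imports Complex_Main "HOL-Library.Extended_Nat"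
begin

section \<open>Operators\<close>

datatype unop = Neg | Next | Finally | Globally

datatype tbinop = Until | Release | WeakUntil | StrongRelease

datatype lbase = Disj | Conj | Implies | Implied | Equiv

text \<open>\<open>Negated b\<close> is the connective obtained by negating the result of \<open>b\<close>, so there are ten
  binary logical operators.\<close>

datatype lbinop = Plain lbase | Negated lbase

fun lbase_sem :: "lbase \<Rightarrow> bool \<Rightarrow> bool \<Rightarrow> bool" where
  "lbase_sem Disj x y = (x \<or> y)"
| "lbase_sem Conj x y = (x \<and> y)"
| "lbase_sem Implies x y = (x \<longrightarrow> y)"
| "lbase_sem Implied x y = (y \<longrightarrow> x)"
| "lbase_sem Equiv x y = (x \<longleftrightarrow> y)"

fun lbin_sem :: "lbinop \<Rightarrow> bool \<Rightarrow> bool \<Rightarrow> bool" where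
  "lbin_sem (Plain b) x y = lbase_sem b x y"
| "lbin_sem (Negated b) x y = (\<not> lbase_sem b x y)"

text \<open>Temporal operators are evaluated at position 0 of a sequence of truth values; position \<open>i\<close>
  carries the truth value of the argument on the \<open>i\<close>-th suffix of a word (LTL), respectively at the
  \<open>i\<close>-th state of a path (ATL).\<close>

fun un_sem :: "unop \<Rightarrow> (nat \<Rightarrow> bool) \<Rightarrow> bool" where
  "un_sem Neg P = (\<not> P 0)"
| "un_sem Next P = P 1"
| "un_sem Finally P = (\<exists>i. P i)"
| "un_sem Globally P = (\<forall>i. P i)"

definition until :: "(nat \<Rightarrow> bool) \<Rightarrow> (nat \<Rightarrow> bool) \<Rightarrow> bool" where
  "until P Q \<longleftrightarrow> (\<exists>i. Q i \<and> (\<forall>j<i. P j))"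

definition release :: "(nat \<Rightarrow> bool) \<Rightarrow> (nat \<Rightarrow> bool) \<Rightarrow> bool" where
  "release P Q \<longleftrightarrow> \<not> until (\<lambda>i. \<not> P i) (\<lambda>i. \<not> Q i)"

fun tbin_sem :: "tbinop \<Rightarrow> (nat \<Rightarrow> bool) \<Rightarrow> (nat \<Rightarrow> bool) \<Rightarrow> bool" where
  "tbin_sem Until P Q = until P Q"
| "tbin_sem Release P Q = release P Q"
| "tbin_sem WeakUntil P Q = (until P Q \<or> un_sem Globally P)"
| "tbin_sem StrongRelease P Q = (release P Q \<and> un_sem Finally P)"


section \<open>LTL\<close>

text \<open>Atomic propositions are natural numbers.\<close>

datatype ltl =
    LProp nat
  | LUn unop ltl
  | LTBin tbinop ltl ltl
  | LLBin lbinop ltl ltl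

primrec ltl_sat :: "(nat \<Rightarrow> nat set) \<Rightarrow> ltl \<Rightarrow> bool" where
  "ltl_sat w (LProp p) = (p \<in> w 0)"
| "ltl_sat w (LUn op \<phi>) = un_sem op (\<lambda>i. ltl_sat (\<lambda>j. w (i + j)) \<phi>)"
| "ltl_sat w (LTBin op \<phi> \<psi>) =
     tbin_sem op (\<lambda>i. ltl_sat (\<lambda>j. w (i + j)) \<phi>) (\<lambda>i. ltl_sat (\<lambda>j. w (i + j)) \<psi>)"
| "ltl_sat w (LLBin op \<phi> \<psi>) = lbin_sem op (ltl_sat w \<phi>) (ltl_sat w \<psi>)"

primrec ltl_frag ::
  "nat set \<Rightarrow> unop set \<Rightarrow> tbinop set \<Rightarrow> lbinop set \<Rightarrow> ltl \<Rightarrow> bool" where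
  "ltl_frag AP Ut Bt Bl (LProp p) = (p \<in> AP)"
| "ltl_frag AP Ut Bt Bl (LUn op \<phi>) = (op \<in> Ut \<and> ltl_frag AP Ut Bt Bl \<phi>)"
| "ltl_frag AP Ut Bt Bl (LTBin op \<phi> \<psi>) =
     (op \<in> Bt \<and> ltl_frag AP Ut Bt Bl \<phi> \<and> ltl_frag AP Ut Bt Bl \<psi>)"
| "ltl_frag AP Ut Bt Bl (LLBin op \<phi> \<psi>) =
     (op \<in> Bl \<and> ltl_frag AP Ut Bt Bl \<phi> \<and> ltl_frag AP Ut Bt Bl \<psi>)"

primrec ltl_sub :: "ltl \<Rightarrow> ltl set" where
  "ltl_sub (LProp p) = {LProp p}"
| "ltl_sub (LUn op \<phi>) = insert (LUn op \<phi>) (ltl_sub \<phi>)"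
| "ltl_sub (LTBin op \<phi> \<psi>) = insert (LTBin op \<phi> \<psi>) (ltl_sub \<phi> \<union> ltl_sub \<psi>)"
| "ltl_sub (LLBin op \<phi> \<psi>) = insert (LLBin op \<phi> \<psi>) (ltl_sub \<phi> \<union> ltl_sub \<psi>)"

fun ltl_is_bin :: "ltl \<Rightarrow> bool" where
  "ltl_is_bin (LTBin op \<phi> \<psi>) = True"
| "ltl_is_bin (LLBin op \<phi> \<psi>) = True"
| "ltl_is_bin _ = False"

definition ltl_size :: "ltl \<Rightarrow> nat" where
  "ltl_size \<phi> = card (ltl_sub \<phi>)"

definition ltl_bin_size :: "ltl \<Rightarrow> nat" where
  "ltl_bin_size \<phi> = card {\<psi> \<in> ltl_sub \<phi>. ltl_is_bin \<psi>}"

text \<open>The pair \<open>(u, v)\<close> represents the ultimately periodic word \<open>u \<cdot> v\<^sup>\<omega>\<close>.\<close>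

type_synonym up_word = "nat set list \<times> nat set list"

fun up_word_at :: "up_word \<Rightarrow> nat \<Rightarrow> nat set" where
  "up_word_at (u, v) i =
     (if i < length u then u ! i else v ! ((i - length u) mod length v))"

definition is_up_word :: "nat set \<Rightarrow> up_word \<Rightarrow> bool" where
  "is_up_word AP w \<longleftrightarrow>
     snd w \<noteq> [] \<and> (\<forall>l \<in> set (fst w) \<union> set (snd w). l \<subseteq> AP)"


section \<open>Concurrent game structures and Kripke structures\<close>

text \<open>The agents are \<open>1, \<dots>, agents C\<close> and the actions of agent \<open>a\<close> at \<open>q\<close> are
  \<open>1, \<dots>, num_acts C q a\<close>. A joint action is the list \<open>[\<alpha>\<^sub>1, \<dots>, \<alpha>\<^sub>k]\<close>, so the action of
  agent \<open>a\<close> has index \<open>a - 1\<close>.\<close>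

record 'q cgs =
  states :: "'q set"
  initial :: "'q set"
  agents :: nat
  props :: "nat set"
  label :: "'q \<Rightarrow> nat set"
  num_acts :: "'q \<Rightarrow> nat \<Rightarrow> nat"
  trans_fun :: "'q \<Rightarrow> nat list \<Rightarrow> 'q"

definition joint_acts :: "'q cgs \<Rightarrow> 'q \<Rightarrow> nat list set" where
  "joint_acts C q =
     {\<alpha>. length \<alpha> = agents C \<and> (\<forall>a \<in> {1..agents C}. \<alpha> ! (a - 1) \<in> {1..num_acts C q a})}"

definition is_cgs :: "'q cgs \<Rightarrow> bool" where
  "is_cgs C \<longleftrightarrow>
     finite (states C) \<and> initial C \<subseteq> states C \<and> agents C \<ge> 1 \<and> finite (props C) \<and>
     (\<forall>q \<in> states C. label C q \<subseteq> props C \<and>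
        (\<forall>a \<in> {1..agents C}. num_acts C q a \<ge> 1) \<and>
        (\<forall>\<alpha> \<in> joint_acts C q. trans_fun C q \<alpha> \<in> states C))"

text \<open>Histories are nonempty lists of states, in chronological order.\<close>

definition is_strategy :: "'q cgs \<Rightarrow> nat \<Rightarrow> ('q list \<Rightarrow> nat) \<Rightarrow> bool" where
  "is_strategy C a \<sigma> \<longleftrightarrow>
     (\<forall>h. h \<noteq> [] \<and> set h \<subseteq> states C \<longrightarrow> \<sigma> h \<in> {1..num_acts C (last h) a})"

definition outcomes ::
  "'q cgs \<Rightarrow> nat set \<Rightarrow> (nat \<Rightarrow> 'q list \<Rightarrow> nat) \<Rightarrow> 'q \<Rightarrow> (nat \<Rightarrow> 'q) set" where
  "outcomes C A s q =
     {\<rho>. \<rho> 0 = q \<and>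
        (\<forall>i. \<exists>\<alpha> \<in> joint_acts C (\<rho> i).
           (\<forall>a \<in> A. \<alpha> ! (a - 1) = s a (map \<rho> [0..<Suc i])) \<and>
           \<rho> (Suc i) = trans_fun C (\<rho> i) \<alpha>)}"

record 'q kripke =
  kstates :: "'q set"
  kinitial :: "'q set"
  kprops :: "nat set"
  klabel :: "'q \<Rightarrow> nat set"
  succs :: "'q \<Rightarrow> 'q set"

definition is_kripke :: "'q kripke \<Rightarrow> bool" where
  "is_kripke K \<longleftrightarrow>
     finite (kstates K) \<and> kinitial K \<subseteq> kstates K \<and> finite (kprops K) \<and>
     (\<forall>q \<in> kstates K. klabel K q \<subseteq> kprops K \<and> succs K q \<noteq> {} \<and> succs K q \<subseteq> kstates K)"

text \<open>A Kripke structure is the one-agent structure in which action \<open>i\<close> of the agent selects the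
  \<open>i\<close>-th successor in increasing order.\<close>

definition cgs_of_kripke :: "('q :: linorder) kripke \<Rightarrow> 'q cgs" where
  "cgs_of_kripke K =
     \<lparr>states = kstates K, initial = kinitial K, agents = 1, props = kprops K, label = klabel K,
      num_acts = (\<lambda>q a. card (succs K q)),
      trans_fun = (\<lambda>q \<alpha>. sorted_list_of_set (succs K q) ! (hd \<alpha> - 1))\<rparr>"


section \<open>ATL and CTL\<close>

text \<open>The type of path formulas contains \<open>PUn Neg \<phi>\<close>, which every fragment excludes.\<close>

datatype atl =
    AProp nat
  | ANeg atl
  | ALBin lbinop atl atl
  | Coal "nat set" atl_path
and atl_path =
    PUn unop atl
  | PTBin tbinop atl atl

primrec atl_sat :: "'q cgs \<Rightarrow> atl \<Rightarrow> 'q \<Rightarrow> bool"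
  and atl_path_sat :: "'q cgs \<Rightarrow> atl_path \<Rightarrow> (nat \<Rightarrow> 'q) \<Rightarrow> bool" where
  "atl_sat C (AProp p) q = (p \<in> label C q)"
| "atl_sat C (ANeg \<phi>) q = (\<not> atl_sat C \<phi> q)"
| "atl_sat C (ALBin op \<phi> \<psi>) q = lbin_sem op (atl_sat C \<phi> q) (atl_sat C \<psi> q)"
| "atl_sat C (Coal A \<psi>) q =
     (\<exists>s. (\<forall>a \<in> A. is_strategy C a (s a)) \<and> (\<forall>\<rho> \<in> outcomes C A s q. atl_path_sat C \<psi> \<rho>))"
| "atl_path_sat C (PUn op \<phi>) \<rho> = un_sem op (\<lambda>i. atl_sat C \<phi> (\<rho> i))"
| "atl_path_sat C (PTBin op \<phi> \<psi>) \<rho> =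
     tbin_sem op (\<lambda>i. atl_sat C \<phi> (\<rho> i)) (\<lambda>i. atl_sat C \<psi> (\<rho> i))"

definition cgs_models :: "'q cgs \<Rightarrow> atl \<Rightarrow> bool" where
  "cgs_models C \<phi> \<longleftrightarrow> (\<forall>q \<in> initial C. atl_sat C \<phi> q)"

primrec atl_frag ::
  "nat \<Rightarrow> nat set \<Rightarrow> unop set \<Rightarrow> tbinop set \<Rightarrow> lbinop set \<Rightarrow> atl \<Rightarrow> bool"
  and atl_path_frag ::
  "nat \<Rightarrow> nat set \<Rightarrow> unop set \<Rightarrow> tbinop set \<Rightarrow> lbinop set \<Rightarrow> atl_path \<Rightarrow> bool" where
  "atl_frag k AP Ut Bt Bl (AProp p) = (p \<in> AP)"
| "atl_frag k AP Ut Bt Bl (ANeg \<phi>) = (Neg \<in> Ut \<and> atl_frag k AP Ut Bt Bl \<phi>)"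
| "atl_frag k AP Ut Bt Bl (ALBin op \<phi> \<psi>) =
     (op \<in> Bl \<and> atl_frag k AP Ut Bt Bl \<phi> \<and> atl_frag k AP Ut Bt Bl \<psi>)"
| "atl_frag k AP Ut Bt Bl (Coal A \<psi>) = (A \<subseteq> {1..k} \<and> atl_path_frag k AP Ut Bt Bl \<psi>)"
| "atl_path_frag k AP Ut Bt Bl (PUn op \<phi>) = (op \<in> Ut - {Neg} \<and> atl_frag k AP Ut Bt Bl \<phi>)"
| "atl_path_frag k AP Ut Bt Bl (PTBin op \<phi> \<psi>) =
     (op \<in> Bt \<and> atl_frag k AP Ut Bt Bl \<phi> \<and> atl_frag k AP Ut Bt Bl \<psi>)"

text \<open>Only state subformulas are collected.\<close>

primrec atl_sub :: "atl \<Rightarrow> atl set"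
  and atl_path_sub :: "atl_path \<Rightarrow> atl set" where
  "atl_sub (AProp p) = {AProp p}"
| "atl_sub (ANeg \<phi>) = insert (ANeg \<phi>) (atl_sub \<phi>)"
| "atl_sub (ALBin op \<phi> \<psi>) = insert (ALBin op \<phi> \<psi>) (atl_sub \<phi> \<union> atl_sub \<psi>)"
| "atl_sub (Coal A \<psi>) = insert (Coal A \<psi>) (atl_path_sub \<psi>)"
| "atl_path_sub (PUn op \<phi>) = atl_sub \<phi>"
| "atl_path_sub (PTBin op \<phi> \<psi>) = atl_sub \<phi> \<union> atl_sub \<psi>"

fun atl_is_bin :: "atl \<Rightarrow> bool" where
  "atl_is_bin (ALBin op \<phi> \<psi>) = True"
| "atl_is_bin (Coal A (PTBin op \<phi> \<psi>)) = True"
| "atl_is_bin _ = False"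

definition atl_size :: "atl \<Rightarrow> nat" where
  "atl_size \<phi> = card (atl_sub \<phi>)"

definition atl_bin_size :: "atl \<Rightarrow> nat" where
  "atl_bin_size \<phi> = card {\<psi> \<in> atl_sub \<phi>. atl_is_bin \<psi>}"


section \<open>Encodings\<close>

text \<open>Instances are strings over \<open>sym\<close>. Propositions are \<open>0, \<dots>, p - 1\<close> and states are
  \<open>0, \<dots>, m - 1\<close>. State numbers, action counts and \<open>p\<close> are bounded by the size of the structure
  they occur in, so writing them in unary keeps encodings polynomial in that size. Every kind of
  component has its own terminator, so that encodings can be parsed uniquely.\<close>

datatype sym = Zero | One | Tick | Dot | Bar | Semi | Hash

instance sym :: finite
proof
  have "(UNIV :: sym set) \<subseteq> {Zero, One, Tick, Dot, Bar, Semi, Hash}"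
    using sym.exhaust by blast
  then show "finite (UNIV :: sym set)"
    by (rule finite_subset) simp
qed

definition enc_num :: "nat \<Rightarrow> sym list" where
  "enc_num n = replicate n Tick @ [Dot]"

definition enc_bit :: "bool \<Rightarrow> sym" where
  "enc_bit b = (if b then One else Zero)"

definition enc_letter :: "nat \<Rightarrow> nat set \<Rightarrow> sym list" where
  "enc_letter p l = map (\<lambda>i. enc_bit (i \<in> l)) [0..<p] @ [Dot]"

definition enc_up_word :: "nat \<Rightarrow> up_word \<Rightarrow> sym list" where
  "enc_up_word p w =
     concat (map (enc_letter p) (fst w)) @ [Bar] @ concat (map (enc_letter p) (snd w)) @ [Semi]"

definition enc_kripke :: "nat \<Rightarrow> nat kripke \<Rightarrow> sym list" where
  "enc_kripke p K =
     concat (map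
       (\<lambda>q. enc_bit (q \<in> kinitial K) # enc_letter p (klabel K q) @
          concat (map enc_num (sorted_list_of_set (succs K q))) @ [Bar])
       [0..<card (kstates K)]) @ [Semi]"

text \<open>The transition table of a state lists the targets of its joint actions in lexicographic
  order.\<close>

definition enc_cgs :: "nat \<Rightarrow> nat cgs \<Rightarrow> sym list" where
  "enc_cgs p C =
     concat (map
       (\<lambda>q. enc_bit (q \<in> initial C) # enc_letter p (label C q) @
          concat (map (\<lambda>a. enc_num (num_acts C q a)) [1..<Suc (agents C)]) @
          concat (map (\<lambda>\<alpha>. enc_num (trans_fun C q \<alpha>))
            (product_lists (map (\<lambda>a. [1..<Suc (num_acts C q a)]) [1..<Suc (agents C)]))) @
          [Bar])
       [0..<card (states C)]) @ [Semi]"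

text \<open>Finite sets of models are presented as lists.\<close>

definition enc_sample ::
  "(nat \<Rightarrow> 'm \<Rightarrow> sym list) \<Rightarrow> nat \<Rightarrow> 'm list \<Rightarrow> 'm list \<Rightarrow> nat \<Rightarrow> sym list" where
  "enc_sample enc p Pos Negs B =
     enc_num p @ concat (map (enc p) Pos) @ [Hash] @ concat (map (enc p) Negs) @ [Hash] @ enc_num B"


section \<open>Learning problems\<close>

text \<open>A learning problem is the language of the encodings of its yes-instances. The parameters are
  the fragment, the two size measures, the satisfaction relation, well-formedness and encoding of
  models (for a given number of propositions), and the bound on the number of binary operators.\<close>

definition learning_problem ::
  "(nat \<Rightarrow> 'f \<Rightarrow> bool) \<Rightarrow> ('f \<Rightarrow> nat) \<Rightarrow> ('f \<Rightarrow> nat) \<Rightarrow> ('m \<Rightarrow> 'f \<Rightarrow> bool) \<Rightarrow>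
   (nat \<Rightarrow> 'm \<Rightarrow> bool) \<Rightarrow> (nat \<Rightarrow> 'm \<Rightarrow> sym list) \<Rightarrow> enat \<Rightarrow> sym list set" where
  "learning_problem frag sz bsz sat ok enc n =
     {enc_sample enc p Pos Negs B | p Pos Negs B.
        (\<forall>m \<in> set Pos \<union> set Negs. ok p m) \<and>
        (\<exists>\<phi>. frag p \<phi> \<and> sz \<phi> \<le> B \<and> enat (bsz \<phi>) \<le> n \<and>
           (\<forall>m \<in> set Pos. sat m \<phi>) \<and> (\<forall>m \<in> set Negs. \<not> sat m \<phi>))}"

definition LTL_Learn ::
  "unop set \<Rightarrow> tbinop set \<Rightarrow> lbinop set \<Rightarrow> enat \<Rightarrow> sym list set" where
  "LTL_Learn Ut Bt Bl n =
     learning_problem (\<lambda>p. ltl_frag {..<p} Ut Bt Bl) ltl_size ltl_bin_size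
       (\<lambda>w. ltl_sat (up_word_at w)) (\<lambda>p. is_up_word {..<p}) enc_up_word n"

definition CTL_Learn ::
  "unop set \<Rightarrow> tbinop set \<Rightarrow> lbinop set \<Rightarrow> enat \<Rightarrow> sym list set" where
  "CTL_Learn Ut Bt Bl n =
     learning_problem (\<lambda>p. atl_frag 1 {..<p} Ut Bt Bl) atl_size atl_bin_size
       (\<lambda>K. cgs_models (cgs_of_kripke K))
       (\<lambda>p K. is_kripke K \<and> kprops K = {..<p} \<and> (\<exists>m. kstates K = {..<m})) enc_kripke n"

definition ATL_Learn ::
  "nat \<Rightarrow> unop set \<Rightarrow> tbinop set \<Rightarrow> lbinop set \<Rightarrow> enat \<Rightarrow> sym list set" where
  "ATL_Learn k Ut Bt Bl n =
     learning_problem (\<lambda>p. atl_frag k {..<p} Ut Bt Bl) atl_size atl_bin_size cgs_models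
       (\<lambda>p C. is_cgs C \<and> agents C = k \<and> props C = {..<p} \<and> (\<exists>m. states C = {..<m})) enc_cgs n"


section \<open>Logarithmic-space reductions\<close>

text \<open>Deterministic Turing machines with a two-way read-only input tape delimited by end markers,
  finitely many one-way infinite work tapes, and a write-only output tape. States and work symbols
  are numbers; the initial state and the blank are 0. The machine halts when no transition applies.\<close>

datatype 'a cell = LeftEnd | Sym 'a | RightEnd

datatype dir = MoveLeft | Stay | MoveRight

record 'a tm =
  num_states :: nat
  num_syms :: nat
  num_tapes :: nat
  delta :: "nat \<Rightarrow> 'a cell \<Rightarrow> nat list \<Rightarrow> (nat \<times> dir \<times> (nat \<times> dir) list \<times> 'a option) option"

definition is_tm :: "'a tm \<Rightarrow> bool" where
  "is_tm M \<longleftrightarrow>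
     num_states M \<ge> 1 \<and> num_syms M \<ge> 1 \<and>
     (\<forall>q < num_states M. \<forall>c ws q' d acts out.
        length ws = num_tapes M \<and> set ws \<subseteq> {..<num_syms M} \<and>
        delta M q c ws = Some (q', d, acts, out) \<longrightarrow>
        q' < num_states M \<and> length acts = num_tapes M \<and> fst ` set acts \<subseteq> {..<num_syms M})"

text \<open>A work tape is given by its head position and its contents.\<close>

type_synonym tape = "nat \<times> (nat \<Rightarrow> nat)"

record 'a config =
  cfg_state :: nat
  cfg_in_pos :: nat
  cfg_tapes :: "tape list"
  cfg_output :: "'a list"

definition init_config :: "'a tm \<Rightarrow> 'a config" where
  "init_config M =
     \<lparr>cfg_state = 0, cfg_in_pos = 0, cfg_tapes = replicate (num_tapes M) (0, \<lambda>_. 0),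
      cfg_output = []\<rparr>"

definition in_cell :: "'a list \<Rightarrow> nat \<Rightarrow> 'a cell" where
  "in_cell x i = (if i = 0 then LeftEnd else if i \<le> length x then Sym (x ! (i - 1)) else RightEnd)"

fun move :: "dir \<Rightarrow> nat \<Rightarrow> nat" where
  "move MoveLeft i = i - 1"
| "move Stay i = i"
| "move MoveRight i = Suc i"

fun write_move :: "nat \<times> dir \<Rightarrow> tape \<Rightarrow> tape" where
  "write_move (s, d) (i, t) = (move d i, t(i := s))"

definition next_action ::
  "'a tm \<Rightarrow> 'a list \<Rightarrow> 'a config \<Rightarrow> (nat \<times> dir \<times> (nat \<times> dir) list \<times> 'a option) option" where
  "next_action M x c =
     delta M (cfg_state c) (in_cell x (cfg_in_pos c)) (map (\<lambda>(i, t). t i) (cfg_tapes c))"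

definition halted :: "'a tm \<Rightarrow> 'a list \<Rightarrow> 'a config \<Rightarrow> bool" where
  "halted M x c \<longleftrightarrow> next_action M x c = None"

text \<open>The input head cannot leave the cells \<open>0, \<dots>, length x + 1\<close> of the input and its end
  markers. Halted configurations are repeated forever.\<close>

definition step :: "'a tm \<Rightarrow> 'a list \<Rightarrow> 'a config \<Rightarrow> 'a config" where
  "step M x c =
     (case next_action M x c of
        None \<Rightarrow> c
      | Some (q, d, acts, out) \<Rightarrow>
          \<lparr>cfg_state = q, cfg_in_pos = min (move d (cfg_in_pos c)) (length x + 1),
           cfg_tapes = map2 write_move acts (cfg_tapes c),
           cfg_output = cfg_output c @ (case out of None \<Rightarrow> [] | Some s \<Rightarrow> [s])\<rparr>)"

definition run :: "'a tm \<Rightarrow> 'a list \<Rightarrow> nat \<Rightarrow> 'a config" where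
  "run M x t = (step M x ^^ t) (init_config M)"

text \<open>Only work tapes count towards the space used. The summand 2 keeps the logarithm positive on
  inputs of length at most 1.\<close>

definition logspace_computable :: "(('a :: finite) list \<Rightarrow> 'a list) \<Rightarrow> bool" where
  "logspace_computable f \<longleftrightarrow>
     (\<exists>M c. is_tm M \<and>
        (\<forall>x. (\<exists>t. halted M x (run M x t) \<and> cfg_output (run M x t) = f x) \<and>
           (\<forall>t. \<forall>(i, _) \<in> set (cfg_tapes (run M x t)).
              real i \<le> c * log 2 (real (length x) + 2))))"

definition logspace_reducible :: "('a :: finite) list set \<Rightarrow> 'a list set \<Rightarrow> bool" (infix "\<le>\<^sub>L" 50) where
  "A \<le>\<^sub>L B \<longleftrightarrow> (\<exists>f. logspace_computable f \<and> (\<forall>x. x \<in> A \<longleftrightarrow> f x \<in> B))"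

end

theory Submission imports Defs begin

text \<open>The word \<open>u \<cdot> v\<^sup>\<omega>\<close> is mapped to the lasso with one state per letter of \<open>u\<close> and \<open>v\<close>, in which
  every agent has a single action. There all strategies have the same unique outcome, so a
  quantifier in front of a temporal operator has no effect: removing the quantifiers and
  inserting \<open>\<langle>\<langle>\<emptyset>\<rangle>\<rangle>\<close> translate between LTL and ATL without increasing either size. The successor
  of a state is written in unary, so the translation of the encodings needs the position in the
  current word and the length of \<open>u\<close>; it reads the input once and keeps them in binary counters.
  Malformed inputs must not become yes-instances: a letter of the wrong length is copied and stays
  malformed, every other defect is detected by a finite automaton.\<close>

section \<open>Counter machines\<close>

text \<open>Both problems are languages of strings, so the equivalence has to hold for strings that
  encode nothing as well, and a yes-instance on the output side supplies an arbitrary structure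
  known only through its encoding. The converse direction therefore works on raw encodings, in which
  a letter is a bit string and a state is a flag, a letter and a list of numbers: they parse
  uniquely, so an output that encodes structures must consist of the lassos of the input words, and
  those structures agree with the lassos on all states. Removing quantifiers can merge subformulas
  but never splits one. A run never counts beyond the number of input symbols read, so the
  transducer can be programmed with increments and zero tests, and a general simulation of such
  programs provides the logarithmic space. The numbers written in front of the target are the only
  difference between Kripke structures and game structures, which lets one transducer serve
  both.\<close>

datatype (targets: 'q, 'a) instr =
  Halt | Jump dir 'q | Emit 'a 'q | Inc nat 'q | Dec nat (if_zero: 'q) (if_pos: 'q)

primrec counters :: "('q, 'a) instr \<Rightarrow> nat set" where
  "counters Halt = {}"
| "counters (Jump d q) = {}"
| "counters (Emit a q) = {}"
| "counters (Inc j q) = {j}"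
| "counters (Dec j q q') = {j}"

text \<open>No rule covers an increment of a counter that has reached \<open>N\<close>, so a
  derivation certifies by itself that the counters stay bounded.\<close>

inductive cstep ::
  "('q \<Rightarrow> 'a cell \<Rightarrow> ('q, 'a) instr) \<Rightarrow> 'a list \<Rightarrow> nat \<Rightarrow>
   'q \<times> nat \<times> nat list \<times> 'a list \<Rightarrow> 'q \<times> nat \<times> nat list \<times> 'a list \<Rightarrow> bool"
  for prog x N where
  jump: "prog q (in_cell x i) = Jump d q' \<Longrightarrow>
    cstep prog x N (q, i, cs, out) (q', min (move d i) (length x + 1), cs, out)"
| emit: "prog q (in_cell x i) = Emit a q' \<Longrightarrow>
    cstep prog x N (q, i, cs, out) (q', i, cs, out @ [a])"
| inc: "prog q (in_cell x i) = Inc j q' \<Longrightarrow> cs ! j < N \<Longrightarrow>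
    cstep prog x N (q, i, cs, out) (q', i, cs[j := Suc (cs ! j)], out)"
| dec_zero: "prog q (in_cell x i) = Dec j q' q'' \<Longrightarrow> cs ! j = 0 \<Longrightarrow>
    cstep prog x N (q, i, cs, out) (q', i, cs, out)"
| dec_pos: "prog q (in_cell x i) = Dec j q' q'' \<Longrightarrow> cs ! j > 0 \<Longrightarrow>
    cstep prog x N (q, i, cs, out) (q'', i, cs[j := cs ! j - 1], out)"


subsection \<open>Binary counters\<close>

primrec val :: "bool list \<Rightarrow> nat" where
  "val [] = 0"
| "val (b # ds) = of_bool b + 2 * val ds"

fun inc_bits :: "bool list \<Rightarrow> bool list" where
  "inc_bits [] = [True]"
| "inc_bits (False # ds) = True # ds"
| "inc_bits (True # ds) = False # inc_bits ds"

fun dec_bits :: "bool list \<Rightarrow> bool list" where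
  "dec_bits [] = []"
| "dec_bits (True # ds) = False # ds"
| "dec_bits (False # ds) = True # dec_bits ds"

lemma val_inc_bits: "val (inc_bits ds) = Suc (val ds)"
  by (induction ds rule: inc_bits.induct) auto

lemma val_dec_bits: "val ds > 0 \<Longrightarrow> val (dec_bits ds) = val ds - 1"
  by (induction ds rule: dec_bits.induct) auto

lemma length_dec_bits [simp]: "length (dec_bits ds) = length ds"
  by (induction ds rule: dec_bits.induct) auto

text \<open>A new digit is needed only if all digits are 1. The equation then bounds the new length
  in terms of the new value, which preserves the length bound in \<open>represents\<close>.\<close>

lemma length_inc_bits:
  "length (inc_bits ds) = length ds \<or>
   length (inc_bits ds) = Suc (length ds) \<and> Suc (val ds) = 2 ^ length ds"
  by (induction ds rule: inc_bits.induct) auto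

lemma val_eq_0_iff: "val ds = 0 \<longleftrightarrow> ds = replicate (length ds) False"
  by (induction ds) auto

text \<open>Cell 0 stays blank, so that the left end of the tape can be recognized; the digits 0 and 1
  are the symbols 1 and 2, least significant digit first.\<close>

definition digit_tape :: "bool list \<Rightarrow> nat \<Rightarrow> nat" where
  "digit_tape ds i = (if i = 0 \<or> i > length ds then 0 else if ds ! (i - 1) then 2 else 1)"

lemma digit_tape_Nil: "digit_tape [] = (\<lambda>_. 0)"
  by (auto simp: digit_tape_def)

lemma digit_tape_0 [simp]: "digit_tape ds 0 = 0"
  by (simp add: digit_tape_def)

lemma digit_tape_eq_0_iff: "digit_tape ds i = 0 \<longleftrightarrow> i = 0 \<or> i > length ds"
  by (simp add: digit_tape_def)

lemma digit_tape_at [simp]: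
  "digit_tape (pre @ b # ds) (Suc (length pre)) = (if b then 2 else 1)"
  by (simp add: digit_tape_def)

lemma digit_tape_end [simp]: "digit_tape pre (Suc (length pre)) = 0"
  by (simp add: digit_tape_def)

lemma digit_tape_upd [simp]:
  "(digit_tape (pre @ b # ds))(Suc (length pre) := (if b' then 2 else 1)) =
     digit_tape (pre @ b' # ds)"
  by (rule ext) (auto simp: digit_tape_def nth_append nth_Cons split: nat.splits)

lemma digit_tape_upd_True [simp]:
  "(digit_tape (pre @ b # ds))(Suc (length pre) := 2) = digit_tape (pre @ True # ds)"
  using digit_tape_upd[of pre b ds True] by simp

lemma digit_tape_upd_False [simp]:
  "(digit_tape (pre @ b # ds))(Suc (length pre) := Suc 0) = digit_tape (pre @ False # ds)"
  using digit_tape_upd[of pre b ds False] by simp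

lemma digit_tape_extend [simp]:
  "(digit_tape pre)(Suc (length pre) := 2) = digit_tape (pre @ [True])"
  by (rule ext) (auto simp: digit_tape_def nth_append)


subsection \<open>Simulation by a Turing machine\<close>

definition keep :: "nat list \<Rightarrow> (nat \<times> dir) list" where
  "keep ws = map (\<lambda>s. (s, Stay)) ws"

text \<open>State \<open>5 * h q\<close> starts the instruction at \<open>q\<close>; the states \<open>5 * h q + i\<close> with \<open>i = 1, 2, 3, 4\<close>
  propagate a carry, propagate a borrow, and bring the head back to cell 0 after a successful
  operation and after an attempt to decrement 0, respectively.\<close>

locale counter_machine =
  fixes prog :: "'q \<Rightarrow> 'a :: finite cell \<Rightarrow> ('q, 'a) instr"
    and r :: nat and Q :: "'q set" and q0 :: 'q and h :: "'q \<Rightarrow> nat"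
  assumes finite_Q: "finite Q"
    and bij_h: "bij_betw h Q {..<card Q}"
    and q0: "q0 \<in> Q" "h q0 = 0"
    and closed: "\<And>q c. q \<in> Q \<Longrightarrow> targets (prog q c) \<subseteq> Q"
    and counters_less: "\<And>q c. q \<in> Q \<Longrightarrow> counters (prog q c) \<subseteq> {..<r}"
begin

definition st :: "'q \<Rightarrow> nat \<Rightarrow> nat" where
  "st q ph = 5 * h q + ph"

lemma st_div_mod: "ph < 5 \<Longrightarrow> st q ph div 5 = h q" "ph < 5 \<Longrightarrow> st q ph mod 5 = ph"
  by (simp_all add: st_def)

text \<open>The input head stands still while a counter operation is under way, so
  \<open>prog q c\<close> yields the same instruction in every phase, and neither the counter nor
  the targets have to be remembered in the state.\<close>

definition tm_delta ::
  "nat \<Rightarrow> 'a cell \<Rightarrow> nat list \<Rightarrow> (nat \<times> dir \<times> (nat \<times> dir) list \<times> 'a option) option" where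
  "tm_delta s c ws =
     (let q = inv_into Q h (s div 5); ph = s mod 5;
          goto = (\<lambda>q'. Some (st q' 0, Stay, keep ws, None));
          act = (\<lambda>ph' j b d. Some (st q ph', Stay, (keep ws)[j := (b, d)], None))
      in case prog q c of
           Halt \<Rightarrow> None
         | Jump d q' \<Rightarrow> if ph = 0 then Some (st q' 0, d, keep ws, None) else None
         | Emit a q' \<Rightarrow> if ph = 0 then Some (st q' 0, Stay, keep ws, Some a) else None
         | Inc j q' \<Rightarrow>
             if ph = 0 then act 1 j (ws ! j) MoveRight
             else if ph = 1 then
               (if ws ! j = 2 then act 1 j 1 MoveRight else act 3 j 2 MoveLeft)
             else if ph = 3 then
               (if ws ! j = 0 then goto q' else act 3 j (ws ! j) MoveLeft)
             else None
         | Dec j q' q'' \<Rightarrow>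
             if ph = 0 then act 2 j (ws ! j) MoveRight
             else if ph = 2 then
               (if ws ! j = 1 then act 2 j 2 MoveRight
                else if ws ! j = 2 then act 3 j 1 MoveLeft
                else act 4 j 0 MoveLeft)
             else if ph = 3 then
               (if ws ! j = 0 then goto q'' else act 3 j (ws ! j) MoveLeft)
             else if ph = 4 then
               (if ws ! j = 0 then goto q' else act 4 j 1 MoveLeft)
             else None)"

definition machine :: "'a tm" where
  "machine = \<lparr>num_states = 5 * card Q, num_syms = 3, num_tapes = r, delta = tm_delta\<rparr>"

lemma h_less: "q \<in> Q \<Longrightarrow> h q < card Q"
  using bij_h by (auto simp: bij_betw_def)

lemma inv_h [simp]: "q \<in> Q \<Longrightarrow> inv_into Q h (h q) = q"
  using bij_h by (simp add: bij_betw_def)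

lemma inv_h_in: "i < card Q \<Longrightarrow> inv_into Q h i \<in> Q"
  using bij_h by (metis bij_betw_def inv_into_into lessThan_iff)

lemma is_tm_machine: "is_tm machine"
proof -
  have c1: "card Q \<ge> 1"
    using q0 finite_Q by (metis One_nat_def Suc_leI card_gt_0_iff empty_iff)
  have c2: "s' < 5 * card Q \<and> length acts = r \<and> fst ` set acts \<subseteq> {..<3}"
    if s: "s < 5 * card Q" and ws: "length ws = r" "set ws \<subseteq> {..<3}"
      and d: "tm_delta s c ws = Some (s', d, acts, out)" for s c ws s' d acts out
  proof -
    define q where "q = inv_into Q h (s div 5)"
    have q: "q \<in> Q"
      using s inv_h_in by (auto simp: q_def)
    have tg: "targets (prog q c) \<subseteq> Q" and cn: "counters (prog q c) \<subseteq> {..<r}"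
      using closed counters_less q by auto
    have lt: "st q' i < 5 * card Q" if "q' \<in> Q" "i < 5" for q' i
      using h_less[OF that(1)] that(2) by (simp add: st_def)
    define good where "good acts \<longleftrightarrow> length acts = r \<and> fst ` set acts \<subseteq> {..<3}"
      for acts :: "(nat \<times> dir) list"
    have k: "good (keep ws)"
      using ws by (auto simp: keep_def good_def)
    have upd: "good ((keep ws)[j := (b, m)])" if "b < 3" for b j m
      using k that set_update_subset_insert[of "keep ws" j "(b, m)"]
      by (fastforce simp: good_def)
    have nth: "ws ! j < 3" if "j < r" for j
      using ws that by (metis lessThan_iff nth_mem subsetD)
    have "s' < 5 * card Q \<and> good acts"
    proof (cases "prog q c")
      case Halt
      then show ?thesis
        using d by (simp add: tm_delta_def flip: q_def)
    next
      case (Jump d q')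
      then show ?thesis
        using d tg k lt by (auto simp: tm_delta_def simp flip: q_def split: if_splits)
    next
      case (Emit a q')
      then show ?thesis
        using d tg k lt by (auto simp: tm_delta_def simp flip: q_def split: if_splits)
    next
      case (Inc j q')
      with cn have "ws ! j < 3"
        using nth by simp
      then show ?thesis
        using d Inc tg k lt q upd
        by (auto simp: tm_delta_def Let_def simp flip: q_def split: if_splits)
    next
      case (Dec j q' q'')
      with cn have "ws ! j < 3"
        using nth by simp
      then show ?thesis
        using d Dec tg k lt q upd
        by (auto simp: tm_delta_def Let_def simp flip: q_def split: if_splits)
    qed
    then show ?thesis
      by (simp add: good_def)
  qed
  show ?thesis
    unfolding is_tm_def machine_def tm.simps
  proof (intro conjI allI impI; (elim conjE)?)
    show "1 \<le> 5 * card Q" "1 \<le> (3 :: nat)"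
      using c1 by simp_all
    fix s c ws s' d acts out
    assume *: "s < 5 * card Q" "length ws = r" "set ws \<subseteq> {..<3}"
      "tm_delta s c ws = Some (s', d, acts, out)"
    show "s' < 5 * card Q" "length acts = r" "fst ` set acts \<subseteq> {..<3}"
      using c2[OF *] by blast+
  qed
qed

section \<open>Configurations, single steps and the transition table\<close>

abbreviation conf :: "nat \<Rightarrow> nat \<Rightarrow> tape list \<Rightarrow> 'a list \<Rightarrow> 'a config" where
  "conf s i ts out \<equiv> \<lparr>cfg_state = s, cfg_in_pos = i, cfg_tapes = ts, cfg_output = out\<rparr>"

definition in_space :: "nat \<Rightarrow> 'a config \<Rightarrow> bool" where
  "in_space S C \<longleftrightarrow> (\<forall>(k, t) \<in> set (cfg_tapes C). k \<le> S)"

definition mstep :: "'a list \<Rightarrow> nat \<Rightarrow> 'a config \<Rightarrow> 'a config \<Rightarrow> bool" where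
  "mstep x S C C' \<longleftrightarrow> C' = step machine x C \<and> in_space S C'"

lemma map2_keep:
  "map2 write_move (keep (map (\<lambda>(i, t). t i) ts)) ts = ts"
  by (induction ts) (auto simp: keep_def)

lemma map2_keep_update:
  assumes "j < length ts" "ts ! j = (k, t)"
  shows "map2 write_move ((keep (map (\<lambda>(i, t). t i) ts))[j := (b, d)]) ts =
    ts[j := (move d k, t(k := b))]"
  using assms by (intro nth_equalityI) (auto simp: keep_def nth_list_update split: prod.splits)

text \<open>Tape \<open>j\<close> appears as an update of a fixed list \<open>ts\<close>, so that
  the successive steps of one operation, which overwrite the same entry, chain without rearranging
  the list.\<close>

lemma mstep_act:
  assumes "tm_delta s (in_cell x i) (map (\<lambda>(i, t). t i) (ts[j := (k, t)])) =
      Some (s', Stay, (keep (map (\<lambda>(i, t). t i) (ts[j := (k, t)])))[j := (b, d)], None)"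
    and "j < length ts" "i \<le> length x + 1" "in_space S (conf s i ts out)" "move d k \<le> S"
  shows "mstep x S (conf s i (ts[j := (k, t)]) out) (conf s' i (ts[j := (move d k, t(k := b))]) out)"
proof -
  have "in_space S (conf s' i (ts[j := (move d k, t(k := b))]) out)"
    using assms(4,5) set_update_subset_insert[of ts j] by (fastforce simp: in_space_def)
  then show ?thesis
    using assms map2_keep_update[of j "ts[j := (k, t)]" k t b d]
    by (simp add: mstep_def step_def next_action_def machine_def)
qed

lemma mstep_goto:
  assumes "tm_delta s (in_cell x i) (map (\<lambda>(i, t). t i) ts) =
      Some (s', d, keep (map (\<lambda>(i, t). t i) ts), a)"
    and "in_space S (conf s i ts out)"
  shows "mstep x S (conf s i ts out)
    (conf s' (min (move d i) (length x + 1)) ts (out @ (case a of None \<Rightarrow> [] | Some b \<Rightarrow> [b])))"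
  using assms by (simp add: mstep_def step_def next_action_def machine_def map2_keep in_space_def)

context
  fixes q :: 'q and c :: "'a cell" and ws :: "nat list"
  assumes q: "q \<in> Q"
begin

lemma delta_halt: "prog q c = Halt \<Longrightarrow> tm_delta (st q 0) c ws = None"
  using q by (simp add: tm_delta_def st_div_mod)

lemma delta_jump:
  "prog q c = Jump d q' \<Longrightarrow> tm_delta (st q 0) c ws =
     Some (st q' 0, d, keep ws, None)"
  using q by (simp add: tm_delta_def st_div_mod)

lemma delta_emit:
  "prog q c = Emit a q' \<Longrightarrow> tm_delta (st q 0) c ws =
     Some (st q' 0, Stay, keep ws, Some a)"
  using q by (simp add: tm_delta_def st_div_mod)

lemma delta_inc:
  "prog q c = Inc j q' \<Longrightarrow> tm_delta (st q 0) c ws =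
     Some (st q 1, Stay, (keep ws)[j := (ws ! j, MoveRight)], None)"
  using q by (simp add: tm_delta_def st_div_mod)

lemma delta_carry:
  "prog q c = Inc j q' \<Longrightarrow> ws ! j = 2 \<Longrightarrow> tm_delta (st q 1) c ws =
     Some (st q 1, Stay, (keep ws)[j := (1, MoveRight)], None)"
  using q by (simp add: tm_delta_def st_div_mod)

lemma delta_carry_end:
  "prog q c = Inc j q' \<Longrightarrow> ws ! j \<noteq> 2 \<Longrightarrow> tm_delta (st q 1) c ws =
     Some (st q 3, Stay, (keep ws)[j := (2, MoveLeft)], None)"
  using q by (simp add: tm_delta_def st_div_mod)

lemma delta_inc_return:
  "prog q c = Inc j q' \<Longrightarrow> ws ! j \<noteq> 0 \<Longrightarrow> tm_delta (st q 3) c ws =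
     Some (st q 3, Stay, (keep ws)[j := (ws ! j, MoveLeft)], None)"
  using q by (simp add: tm_delta_def st_div_mod)

lemma delta_inc_end:
  "prog q c = Inc j q' \<Longrightarrow> ws ! j = 0 \<Longrightarrow> tm_delta (st q 3) c ws =
     Some (st q' 0, Stay, keep ws, None)"
  using q by (simp add: tm_delta_def st_div_mod)

lemma delta_dec:
  "prog q c = Dec j q' q'' \<Longrightarrow> tm_delta (st q 0) c ws =
     Some (st q 2, Stay, (keep ws)[j := (ws ! j, MoveRight)], None)"
  using q by (simp add: tm_delta_def st_div_mod)

lemma delta_borrow:
  "prog q c = Dec j q' q'' \<Longrightarrow> ws ! j = 1 \<Longrightarrow> tm_delta (st q 2) c ws =
     Some (st q 2, Stay, (keep ws)[j := (2, MoveRight)], None)"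
  using q by (simp add: tm_delta_def st_div_mod)

lemma delta_borrow_pos:
  "prog q c = Dec j q' q'' \<Longrightarrow> ws ! j = 2 \<Longrightarrow> tm_delta (st q 2) c ws =
     Some (st q 3, Stay, (keep ws)[j := (1, MoveLeft)], None)"
  using q by (simp add: tm_delta_def st_div_mod)

lemma delta_borrow_zero:
  "prog q c = Dec j q' q'' \<Longrightarrow> ws ! j = 0 \<Longrightarrow> tm_delta (st q 2) c ws =
     Some (st q 4, Stay, (keep ws)[j := (0, MoveLeft)], None)"
  using q by (simp add: tm_delta_def st_div_mod)

lemma delta_pos_return:
  "prog q c = Dec j q' q'' \<Longrightarrow> ws ! j \<noteq> 0 \<Longrightarrow> tm_delta (st q 3) c ws =
     Some (st q 3, Stay, (keep ws)[j := (ws ! j, MoveLeft)], None)"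
  using q by (simp add: tm_delta_def st_div_mod)

lemma delta_pos_end:
  "prog q c = Dec j q' q'' \<Longrightarrow> ws ! j = 0 \<Longrightarrow> tm_delta (st q 3) c ws =
     Some (st q'' 0, Stay, keep ws, None)"
  using q by (simp add: tm_delta_def st_div_mod)

lemma delta_zero_return:
  "prog q c = Dec j q' q'' \<Longrightarrow> ws ! j \<noteq> 0 \<Longrightarrow> tm_delta (st q 4) c ws =
     Some (st q 4, Stay, (keep ws)[j := (1, MoveLeft)], None)"
  using q by (simp add: tm_delta_def st_div_mod)

lemma delta_zero_end:
  "prog q c = Dec j q' q'' \<Longrightarrow> ws ! j = 0 \<Longrightarrow> tm_delta (st q 4) c ws =
     Some (st q' 0, Stay, keep ws, None)"
  using q by (simp add: tm_delta_def st_div_mod)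

end

text \<open>The digits \<open>pre\<close> already passed by the head are generalized, as the carry
  moves on by one digit in each step of the induction. The head also inspects the blank behind the
  numeral, so the length must be strictly below \<open>S\<close>. Of the final position only a bound
  matters for the way back.\<close>

lemma carry:
  assumes q: "q \<in> Q" and p: "prog q (in_cell x i) = Inc j q'"
    and j: "j < length ts" and i: "i \<le> length x + 1"
    and S: "\<And>s. in_space S (conf s i ts out)"
    and len: "length pre + length ds < S"
  shows "\<exists>k \<le> length pre + length ds.
    (mstep x S)\<^sup>*\<^sup>* (conf (st q 1) i (ts[j := (Suc (length pre), digit_tape (pre @ ds))]) out)
       (conf (st q 3) i (ts[j := (k, digit_tape (pre @ inc_bits ds))]) out)"
  using len
proof (induction ds arbitrary: pre rule: inc_bits.induct)
  case 1
  have "mstep x S (conf (st q 1) i (ts[j := (Suc (length pre), digit_tape pre)]) out)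
     (conf (st q 3) i (ts[j := (move MoveLeft (Suc (length pre)),
        (digit_tape pre)(Suc (length pre) := 2))]) out)"
    by (rule mstep_act[OF delta_carry_end[OF q p]]) (use 1 i S j in auto)
  then show ?case
    by (auto intro!: exI[of _ "length pre"])
next
  case (2 ds)
  have "mstep x S (conf (st q 1) i (ts[j := (Suc (length pre), digit_tape (pre @ False # ds))]) out)
     (conf (st q 3) i (ts[j := (move MoveLeft (Suc (length pre)),
        (digit_tape (pre @ False # ds))(Suc (length pre) := 2))]) out)"
    by (rule mstep_act[OF delta_carry_end[OF q p]]) (use 2 i S j in auto)
  then show ?case
    by (auto intro!: exI[of _ "length pre"])
next
  case (3 ds)
  have "mstep x S (conf (st q 1) i (ts[j := (Suc (length pre), digit_tape (pre @ True # ds))]) out)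
     (conf (st q 1) i (ts[j := (move MoveRight (Suc (length pre)),
        (digit_tape (pre @ True # ds))(Suc (length pre) := 1))]) out)"
    by (rule mstep_act[OF delta_carry[OF q p]]) (use 3 i S j in auto)
  moreover have "\<exists>k \<le> length (pre @ [False]) + length ds.
    (mstep x S)\<^sup>*\<^sup>*
       (conf (st q 1) i (ts[j := (Suc (length (pre @ [False])), digit_tape ((pre @ [False]) @ ds))]) out)
       (conf (st q 3) i (ts[j := (k, digit_tape ((pre @ [False]) @ inc_bits ds))]) out)"
    using 3 by (intro "3.IH") auto
  then obtain k where "k \<le> length (pre @ [False]) + length ds"
    "(mstep x S)\<^sup>*\<^sup>*
       (conf (st q 1) i (ts[j := (Suc (length (pre @ [False])), digit_tape ((pre @ [False]) @ ds))]) out)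
       (conf (st q 3) i (ts[j := (k, digit_tape ((pre @ [False]) @ inc_bits ds))]) out)"
    by blast
  ultimately show ?case
    by (auto intro!: exI[of _ k] intro: converse_rtranclp_into_rtranclp)
qed

text \<open>A positive value has a digit 1, so the borrow stops inside the numeral and never meets
  the blank.\<close>

lemma borrow_pos:
  assumes q: "q \<in> Q" and p: "prog q (in_cell x i) = Dec j q' q''"
    and j: "j < length ts" and i: "i \<le> length x + 1"
    and S: "\<And>s. in_space S (conf s i ts out)"
    and len: "length pre + length ds < S" and "val ds > 0"
  shows "\<exists>k \<le> length pre + length ds.
    (mstep x S)\<^sup>*\<^sup>* (conf (st q 2) i (ts[j := (Suc (length pre), digit_tape (pre @ ds))]) out)
       (conf (st q 3) i (ts[j := (k, digit_tape (pre @ dec_bits ds))]) out)"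
  using len \<open>val ds > 0\<close>
proof (induction ds arbitrary: pre rule: dec_bits.induct)
  case 1
  then show ?case by simp
next
  case (2 ds)
  have "mstep x S (conf (st q 2) i (ts[j := (Suc (length pre), digit_tape (pre @ True # ds))]) out)
     (conf (st q 3) i (ts[j := (move MoveLeft (Suc (length pre)),
        (digit_tape (pre @ True # ds))(Suc (length pre) := 1))]) out)"
    by (rule mstep_act[OF delta_borrow_pos[OF q p]]) (use 2 i S j in auto)
  then show ?case
    by (auto intro!: exI[of _ "length pre"])
next
  case (3 ds)
  have "mstep x S (conf (st q 2) i (ts[j := (Suc (length pre), digit_tape (pre @ False # ds))]) out)
     (conf (st q 2) i (ts[j := (move MoveRight (Suc (length pre)),
        (digit_tape (pre @ False # ds))(Suc (length pre) := 2))]) out)"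
    by (rule mstep_act[OF delta_borrow[OF q p]]) (use 3 i S j in auto)
  moreover have "\<exists>k \<le> length (pre @ [True]) + length ds.
    (mstep x S)\<^sup>*\<^sup>*
       (conf (st q 2) i (ts[j := (Suc (length (pre @ [True])), digit_tape ((pre @ [True]) @ ds))]) out)
       (conf (st q 3) i (ts[j := (k, digit_tape ((pre @ [True]) @ dec_bits ds))]) out)"
    using 3 by (intro "3.IH") auto
  then obtain k where "k \<le> length (pre @ [True]) + length ds"
    "(mstep x S)\<^sup>*\<^sup>*
       (conf (st q 2) i (ts[j := (Suc (length (pre @ [True])), digit_tape ((pre @ [True]) @ ds))]) out)
       (conf (st q 3) i (ts[j := (k, digit_tape ((pre @ [True]) @ dec_bits ds))]) out)"
    by blast
  ultimately show ?case
    by (auto intro!: exI[of _ k] intro: converse_rtranclp_into_rtranclp)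
qed

text \<open>The zero test: in a numeral of value 0 the borrow turns every digit into 1 and only then
  meets the blank. The phase is 4 rather than 3, so that the way back can undo the damage.\<close>

lemma borrow_zero:
  assumes q: "q \<in> Q" and p: "prog q (in_cell x i) = Dec j q' q''"
    and j: "j < length ts" and i: "i \<le> length x + 1"
    and S: "\<And>s. in_space S (conf s i ts out)"
    and len: "length pre + n < S"
  shows "(mstep x S)\<^sup>*\<^sup>*
       (conf (st q 2) i (ts[j := (Suc (length pre), digit_tape (pre @ replicate n False))]) out)
       (conf (st q 4) i (ts[j := (length pre + n, digit_tape (pre @ replicate n True))]) out)"
  using len
proof (induction n arbitrary: pre)
  case 0
  have "mstep x S (conf (st q 2) i (ts[j := (Suc (length pre), digit_tape pre)]) out)
     (conf (st q 4) i (ts[j := (move MoveLeft (Suc (length pre)),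
        (digit_tape pre)(Suc (length pre) := 0))]) out)"
    by (rule mstep_act[OF delta_borrow_zero[OF q p]]) (use 0 i S j in auto)
  moreover have "(digit_tape pre)(Suc (length pre) := 0) = digit_tape pre"
    by (simp add: fun_upd_idem)
  ultimately show ?case
    by auto
next
  case (Suc n)
  have "mstep x S (conf (st q 2) i (ts[j := (Suc (length pre), digit_tape (pre @ False # replicate n False))]) out)
     (conf (st q 2) i (ts[j := (move MoveRight (Suc (length pre)),
        (digit_tape (pre @ False # replicate n False))(Suc (length pre) := 2))]) out)"
    by (rule mstep_act[OF delta_borrow[OF q p]]) (use Suc i S j in auto)
  then show ?case
    using Suc.IH[of "pre @ [True]"] Suc.prems by (auto intro: converse_rtranclp_into_rtranclp)
qed

text \<open>Increments and successful decrements leave the correct digits behind and share phase 3.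
  Digits are nonzero symbols, so the first blank met on the way left is cell 0.\<close>

lemma return_ok:
  assumes q: "q \<in> Q" and p: "prog q (in_cell x i) = Inc j q' \<or> prog q (in_cell x i) = Dec j q'' q'"
    and j: "j < length ts" and i: "i \<le> length x + 1"
    and S: "\<And>s. in_space S (conf s i ts out)"
    and "k \<le> length ds" "k \<le> S"
  shows "(mstep x S)\<^sup>*\<^sup>* (conf (st q 3) i (ts[j := (k, digit_tape ds)]) out)
       (conf (st q' 0) i (ts[j := (0, digit_tape ds)]) out)"
proof -
  have delta_end: "tm_delta (st q 3) (in_cell x i) ws = Some (st q' 0, Stay, keep ws, None)"
    if "ws ! j = 0" for ws
    using p delta_inc_end[OF q] delta_pos_end[OF q] that by blast
  have delta_return: "tm_delta (st q 3) (in_cell x i) ws = Some (st q 3, Stay, (keep ws)[j := (b, MoveLeft)], None)"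
    if "ws ! j = b" "b \<noteq> 0" for ws b
    using p delta_inc_return[OF q] delta_pos_return[OF q] that by metis
  show ?thesis
    using \<open>k \<le> length ds\<close> \<open>k \<le> S\<close>
  proof (induction k)
    case 0
    have "in_space S (conf (st q 3) i (ts[j := (0, digit_tape ds)]) out)"
      using S set_update_subset_insert[of ts j] by (fastforce simp: in_space_def)
    then have "mstep x S (conf (st q 3) i (ts[j := (0, digit_tape ds)]) out)
       (conf (st q' 0) (min (move Stay i) (length x + 1)) (ts[j := (0, digit_tape ds)])
         (out @ (case None of None \<Rightarrow> [] | Some b \<Rightarrow> [b])))"
      by (intro mstep_goto delta_end) (use j in auto)
    then show ?case
      using i by auto
  next
    case (Suc k)
    have "mstep x S (conf (st q 3) i (ts[j := (Suc k, digit_tape ds)]) out)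
       (conf (st q 3) i (ts[j := (move MoveLeft (Suc k),
          (digit_tape ds)(Suc k := digit_tape ds (Suc k)))]) out)"
      by (intro mstep_act i S delta_return) (use Suc j in \<open>auto simp: digit_tape_eq_0_iff\<close>)
    then show ?case
      using Suc by (auto intro: converse_rtranclp_into_rtranclp)
  qed
qed

text \<open>The induction splits the numeral at the head: the digits up to it are still 1, those
  beyond have been reset to 0. The phase is entered with \<open>n = 0\<close>.\<close>

lemma return_zero:
  assumes q: "q \<in> Q" and p: "prog q (in_cell x i) = Dec j q' q''"
    and j: "j < length ts" and i: "i \<le> length x + 1"
    and S: "\<And>s. in_space S (conf s i ts out)" and "k \<le> S"
  shows "(mstep x S)\<^sup>*\<^sup>*
       (conf (st q 4) i (ts[j := (k, digit_tape (replicate k True @ replicate n False))]) out)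
       (conf (st q' 0) i (ts[j := (0, digit_tape (replicate (k + n) False))]) out)"
  using \<open>k \<le> S\<close>
proof (induction k arbitrary: n)
  case 0
  have "in_space S (conf (st q 4) i (ts[j := (0, digit_tape (replicate n False))]) out)"
    using S set_update_subset_insert[of ts j] by (fastforce simp: in_space_def)
  then have "mstep x S (conf (st q 4) i (ts[j := (0, digit_tape (replicate n False))]) out)
     (conf (st q' 0) (min (move Stay i) (length x + 1)) (ts[j := (0, digit_tape (replicate n False))])
       (out @ (case None of None \<Rightarrow> [] | Some b \<Rightarrow> [b])))"
    by (intro mstep_goto delta_zero_end[OF q p]) (use j in auto)
  then show ?case
    using i by auto
next
  case (Suc k)
  let ?t = "digit_tape (replicate k True @ True # replicate n False)"
  have eq: "replicate (Suc k) True @ replicate n False = replicate k True @ True # replicate n False"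
    by (simp add: replicate_app_Cons_same)
  have t: "?t (Suc k) = 2" "?t(Suc k := 1) = digit_tape (replicate k True @ replicate (Suc n) False)"
    using digit_tape_at[of "replicate k True" True "replicate n False"]
      digit_tape_upd_False[of "replicate k True" True "replicate n False"] by simp_all
  have "mstep x S (conf (st q 4) i (ts[j := (Suc k, ?t)]) out)
     (conf (st q 4) i (ts[j := (move MoveLeft (Suc k), ?t(Suc k := 1))]) out)"
    by (rule mstep_act[OF delta_zero_return[OF q p]]) (use Suc i S j t(1) in auto)
  then show ?case
    using Suc.IH[of "Suc n"] Suc.prems unfolding eq t(2)
    by (auto intro: converse_rtranclp_into_rtranclp)
qed

section \<open>From counter instructions to machine runs\<close>

definition tapes :: "bool list list \<Rightarrow> tape list" where
  "tapes dss = map (\<lambda>ds. (0, digit_tape ds)) dss"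

lemma in_space_tapes: "in_space S (conf s i (tapes dss) out)"
  by (auto simp: in_space_def tapes_def)

lemma tapes_update: "tapes (dss[j := ds]) = (tapes dss)[j := (0, digit_tape ds)]"
  by (simp add: tapes_def map_update)

lemma tapes_nth: "j < length dss \<Longrightarrow> tapes dss ! j = (0, digit_tape (dss ! j))"
  by (simp add: tapes_def)

lemma start_op:
  assumes q: "q \<in> Q"
    and p: "prog q (in_cell x i) = Inc j q' \<and> b = 1 \<or> prog q (in_cell x i) = Dec j q' q'' \<and> b = 2"
    and j: "j < length dss" and i: "i \<le> length x + 1" and S1: "S \<ge> 1"
  shows "mstep x S (conf (st q 0) i (tapes dss) out)
    (conf (st q b) i ((tapes dss)[j := (1, digit_tape (dss ! j))]) out)"
proof -
  have delta_start: "tm_delta (st q 0) (in_cell x i) ws = Some (st q b, Stay, (keep ws)[j := (b', MoveRight)], None)"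
    if "ws ! j = b'" for ws b'
    using p delta_inc[OF q] delta_dec[OF q] that by auto
  have "mstep x S (conf (st q 0) i ((tapes dss)[j := (0, digit_tape (dss ! j))]) out)
    (conf (st q b) i ((tapes dss)[j := (move MoveRight 0,
      (digit_tape (dss ! j))(0 := digit_tape (dss ! j) 0))]) out)"
    using p S1 by (intro mstep_act i in_space_tapes delta_start) (use j in \<open>auto simp: tapes_def\<close>)
  moreover have "(digit_tape (dss ! j))(0 := digit_tape (dss ! j) 0) = digit_tape (dss ! j)"
    by (rule fun_upd_triv)
  ultimately show ?thesis
    using tapes_nth[OF j] by (simp flip: tapes_update)
qed

text \<open>Decrementing never shortens a numeral, so leading zeros can accumulate and the value
  does not bound the length. The factor 2 leaves room for the digit that appears when a value
  reaches a power of two.\<close>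

fun represents :: "nat \<Rightarrow> nat list \<Rightarrow> bool list list \<Rightarrow> bool" where
  "represents N cs dss \<longleftrightarrow> cs = map val dss \<and> length dss = r \<and> (\<forall>ds \<in> set dss. 2 ^ length ds \<le> 2 * N)"

lemma represents_update:
  assumes "represents N cs dss" "2 ^ length ds \<le> 2 * N"
  shows "represents N (cs[j := val ds]) (dss[j := ds])"
  using assms set_update_subset_insert[of dss j ds] by (auto simp: map_update)

lemma simulate_cstep:
  assumes "cstep prog x N (q, i, cs, out) (q', i', cs', out')"
    and q: "q \<in> Q" and i: "i \<le> length x + 1" and cs: "represents N cs dss"
    and S: "\<And>l. 2 ^ l \<le> 2 * N \<Longrightarrow> l < S" and N: "N \<ge> 1"
  shows "q' \<in> Q \<and> i' \<le> length x + 1 \<and> (\<exists>dss'. represents N cs' dss' \<and>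
    (mstep x S)\<^sup>*\<^sup>* (conf (st q 0) i (tapes dss) out) (conf (st q' 0) i' (tapes dss') out'))"
proof -
  have tg: "targets (prog q (in_cell x i)) \<subseteq> Q" and cn: "counters (prog q (in_cell x i)) \<subseteq> {..<r}"
    using closed counters_less q by auto
  have S1: "S \<ge> 1"
    using S[of 0] N by simp
  have len: "length dss = r" "length (tapes dss) = r"
    using cs by (auto simp: tapes_def)
  have ds: "2 ^ length (dss ! j) \<le> 2 * N" "length (dss ! j) < S" "val (dss ! j) = cs ! j"
    if "j < r" for j
    using cs that S by auto
  from assms(1) show ?thesis
  proof cases
    case (jump d)
    have "mstep x S (conf (st q 0) i (tapes dss) out)
      (conf (st q' 0) (min (move d i) (length x + 1)) (tapes dss)
         (out @ (case None of None \<Rightarrow> [] | Some b \<Rightarrow> [b])))"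
      using jump q by (intro mstep_goto in_space_tapes delta_jump) auto
    then show ?thesis
      using jump tg cs by (auto intro!: exI[of _ dss])
  next
    case (emit a)
    have "mstep x S (conf (st q 0) i (tapes dss) out)
      (conf (st q' 0) (min (move Stay i) (length x + 1)) (tapes dss)
         (out @ (case Some a of None \<Rightarrow> [] | Some b \<Rightarrow> [b])))"
      using emit q by (intro mstep_goto in_space_tapes delta_emit) auto
    then show ?thesis
      using emit tg cs i by (auto intro!: exI[of _ dss])
  next
    case (inc j)
    have j: "j < r"
      using cn inc by auto
    have p: "prog q (in_cell x i) = Inc j q'"
      using inc by simp
    let ?ds = "dss ! j"
    have len': "length ?ds \<le> length (inc_bits ?ds)" "2 ^ length (inc_bits ?ds) \<le> 2 * N"
      using length_inc_bits[of ?ds] ds[OF j] inc by auto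
    obtain k where k: "k \<le> length ?ds" and
      "(mstep x S)\<^sup>*\<^sup>* (conf (st q 1) i ((tapes dss)[j := (1, digit_tape ?ds)]) out)
       (conf (st q 3) i ((tapes dss)[j := (k, digit_tape (inc_bits ?ds))]) out)"
      using carry[where ts = "tapes dss" and S = S and pre = "[]" and ds = "?ds", OF q p _ i in_space_tapes] ds[OF j] len j by auto
    moreover have "mstep x S (conf (st q 0) i (tapes dss) out)
        (conf (st q 1) i ((tapes dss)[j := (1, digit_tape ?ds)]) out)"
      using start_op[OF q _ _ i S1] inc j len by blast
    moreover have "(mstep x S)\<^sup>*\<^sup>* (conf (st q 3) i ((tapes dss)[j := (k, digit_tape (inc_bits ?ds))]) out)
        (conf (st q' 0) i ((tapes dss)[j := (0, digit_tape (inc_bits ?ds))]) out)"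
      using return_ok[where ts = "tapes dss" and S = S and k = k and ds = "inc_bits ?ds" and j = j and q' = q', OF q _ _ i in_space_tapes]
        inc j len k len' ds[OF j] by auto
    ultimately have "(mstep x S)\<^sup>*\<^sup>* (conf (st q 0) i (tapes dss) out)
        (conf (st q' 0) i (tapes (dss[j := inc_bits ?ds])) out)"
      by (simp add: tapes_update)
    moreover have "represents N cs' (dss[j := inc_bits ?ds])"
      using represents_update[OF cs len'(2), of j] inc ds[OF j] by (simp add: val_inc_bits)
    ultimately show ?thesis
      using inc tg i by auto
  next
    case (dec_zero j q'')
    have j: "j < r"
      using cn dec_zero by auto
    have p: "prog q (in_cell x i) = Dec j q' q''"
      using dec_zero by simp
    let ?ds = "dss ! j" let ?n = "length (dss ! j)"
    have rep: "replicate ?n False = ?ds"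
      using dec_zero ds[OF j] val_eq_0_iff by metis
    have "(mstep x S)\<^sup>*\<^sup>* (conf (st q 2) i ((tapes dss)[j := (1, digit_tape ?ds)]) out)
       (conf (st q 4) i ((tapes dss)[j := (?n, digit_tape (replicate ?n True))]) out)"
      using borrow_zero[where ts = "tapes dss" and S = S and pre = "[]" and n = "?n", OF q p _ i in_space_tapes] ds[OF j] len j rep
      by auto
    moreover have "mstep x S (conf (st q 0) i (tapes dss) out)
        (conf (st q 2) i ((tapes dss)[j := (1, digit_tape ?ds)]) out)"
      using start_op[OF q _ _ i S1] dec_zero j len by blast
    moreover have "(mstep x S)\<^sup>*\<^sup>*
        (conf (st q 4) i ((tapes dss)[j := (?n, digit_tape (replicate ?n True))]) out)
        (conf (st q' 0) i ((tapes dss)[j := (0, digit_tape ?ds)]) out)"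
      using return_zero[where ts = "tapes dss" and S = S and k = "?n" and n = 0, OF q p _ i in_space_tapes] ds[OF j] len j rep
      by auto
    moreover have "(tapes dss)[j := (0, digit_tape ?ds)] = tapes dss"
      using tapes_nth[of j dss] j len by (metis list_update_id)
    ultimately have "(mstep x S)\<^sup>*\<^sup>* (conf (st q 0) i (tapes dss) out)
        (conf (st q' 0) i (tapes dss) out)"
      by simp
    then show ?thesis
      using dec_zero tg i cs by auto
  next
    case (dec_pos j q'')
    have j: "j < r"
      using cn dec_pos by auto
    have p: "prog q (in_cell x i) = Dec j q'' q'"
      using dec_pos by simp
    let ?ds = "dss ! j"
    obtain k where k: "k \<le> length ?ds" and
      "(mstep x S)\<^sup>*\<^sup>* (conf (st q 2) i ((tapes dss)[j := (1, digit_tape ?ds)]) out)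
       (conf (st q 3) i ((tapes dss)[j := (k, digit_tape (dec_bits ?ds))]) out)"
      using borrow_pos[where ts = "tapes dss" and S = S and pre = "[]" and ds = "?ds", OF q p _ i in_space_tapes] ds[OF j] len j dec_pos
      by auto
    moreover have "mstep x S (conf (st q 0) i (tapes dss) out)
        (conf (st q 2) i ((tapes dss)[j := (1, digit_tape ?ds)]) out)"
      using start_op[OF q _ _ i S1] dec_pos j len by blast
    moreover have "(mstep x S)\<^sup>*\<^sup>* (conf (st q 3) i ((tapes dss)[j := (k, digit_tape (dec_bits ?ds))]) out)
        (conf (st q' 0) i ((tapes dss)[j := (0, digit_tape (dec_bits ?ds))]) out)"
      using return_ok[where ts = "tapes dss" and S = S and k = k and ds = "dec_bits ?ds" and j = j and q' = q', OF q _ _ i in_space_tapes]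
        dec_pos j len k ds[OF j] by auto
    ultimately have "(mstep x S)\<^sup>*\<^sup>* (conf (st q 0) i (tapes dss) out)
        (conf (st q' 0) i (tapes (dss[j := dec_bits ?ds])) out)"
      by (simp add: tapes_update)
    moreover have "represents N cs' (dss[j := dec_bits ?ds])"
      using represents_update[OF cs, of "dec_bits ?ds" j] dec_pos ds[OF j] by (simp add: val_dec_bits)
    ultimately show ?thesis
      using dec_pos tg i by auto
  qed
qed

lemma simulate:
  assumes "(cstep prog x N)\<^sup>*\<^sup>* (q0, 0, replicate r 0, []) (q, i, cs, out)"
    and S: "\<And>l. 2 ^ l \<le> 2 * N \<Longrightarrow> l < S" and N: "N \<ge> 1"
  shows "q \<in> Q \<and> i \<le> length x + 1 \<and> (\<exists>dss. represents N cs dss \<and>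
    (mstep x S)\<^sup>*\<^sup>* (init_config machine) (conf (st q 0) i (tapes dss) out))"
  using assms(1)
proof (induction "(q, i, cs, out)" arbitrary: q i cs out rule: rtranclp_induct)
  case base
  have "represents N (replicate r 0) (replicate r [])"
    using N by auto
  moreover have "init_config machine = conf (st q0 0) 0 (tapes (replicate r [])) []"
    by (simp add: init_config_def machine_def st_def q0 tapes_def digit_tape_Nil)
  ultimately show ?case
    using base q0 by (metis Pair_inject le0 rtranclp.rtrancl_refl)
next
  case (step c)
  obtain q1 i1 cs1 out1 where c: "c = (q1, i1, cs1, out1)"
    by (cases c)
  with step obtain dss where *: "q1 \<in> Q" "i1 \<le> length x + 1" "represents N cs1 dss"
    "(mstep x S)\<^sup>*\<^sup>* (init_config machine) (conf (st q1 0) i1 (tapes dss) out1)"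
    by blast
  show ?case
    using simulate_cstep[OF step(2)[unfolded c] *(1-3) S N] *(4) by (meson rtranclp_trans)
qed

text \<open>Up to the halting configuration the space bound holds along the path of
  \<open>mstep\<close>; afterwards \<open>step\<close> repeats that configuration, so it holds at
  all times.\<close>

lemma mstep_run:
  assumes "(mstep x S)\<^sup>*\<^sup>* (init_config machine) C" and "halted machine x C"
  shows "(\<exists>t. run machine x t = C) \<and> (\<forall>t. in_space S (run machine x t))"
proof -
  have "\<exists>t. run machine x t = C \<and> (\<forall>t' \<le> t. in_space S (run machine x t'))"
    using assms(1)
  proof (induction rule: rtranclp_induct)
    case base
    show ?case
      by (rule exI[of _ 0]) (auto simp: run_def init_config_def in_space_def)
  next
    case (step C C')
    then obtain t where "run machine x t = C" "\<forall>t' \<le> t. in_space S (run machine x t')"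
      by blast
    then show ?case
      using step(2) by (intro exI[of _ "Suc t"]) (auto simp: run_def mstep_def le_Suc_eq)
  qed
  then obtain t where t: "run machine x t = C" "\<forall>t' \<le> t. in_space S (run machine x t')"
    by blast
  have "run machine x (t + n) = C" for n
  proof (induction n)
    case (Suc n)
    then show ?case
      using assms(2) by (simp add: run_def step_def halted_def)
  qed (simp add: t)
  then have "in_space S (run machine x t')" for t'
    using t by (metis le_add_diff_inverse nat_le_linear)
  then show ?thesis
    using t by blast
qed

text \<open>\<open>S\<close> has to exceed every admissible numeral length because the head reaches
  the blank behind the last digit. With \<open>L = log 2 (n + 2)\<close>, which is at least 1, the
  chosen \<open>S\<close> is at most \<open>L + 2\<close> and hence below
  \<open>4 * L\<close>.\<close>

lemma logspace_bound:
  "\<exists>S. (\<forall>l. 2 ^ l \<le> 2 * Suc n \<longrightarrow> l < S) \<and> real S \<le> 4 * log 2 (real n + 2)"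
proof (intro exI conjI allI impI)
  let ?S = "nat \<lfloor>log 2 (real (2 * Suc n))\<rfloor> + 1"
  show "l < ?S" if "2 ^ l \<le> 2 * Suc n" for l
  proof -
    have "(2 :: real) ^ l \<le> real (2 * Suc n)"
      using that by (metis of_nat_le_iff of_nat_numeral of_nat_power)
    then have "real l \<le> log 2 (real (2 * Suc n))"
      by (simp add: le_log_iff powr_realpow)
    then have "int l \<le> \<lfloor>log 2 (real (2 * Suc n))\<rfloor>"
      by (simp add: le_floor_iff)
    then show ?thesis
      by linarith
  qed
  have ge1: "1 \<le> log 2 (real n + 2)"
    by simp
  have "log 2 (real (2 * Suc n)) = 1 + log 2 (real n + 1)"
    using log_mult[of 2 "real n + 1" 2] by (simp add: algebra_simps)
  also have "\<dots> \<le> 1 + log 2 (real n + 2)"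
    by simp
  finally have "log 2 (real (2 * Suc n)) \<le> 1 + log 2 (real n + 2)" .
  moreover have "0 \<le> log 2 (real (2 * Suc n))"
    by (simp add: zero_le_log_cancel_iff)
  ultimately show "real ?S \<le> 4 * log 2 (real n + 2)"
    using ge1 by linarith
qed

lemma logspace_computable:
  assumes "\<And>x. \<exists>q i cs. (cstep prog x (Suc (length x)))\<^sup>*\<^sup>* (q0, 0, replicate r 0, []) (q, i, cs, f x) \<and>
    prog q (in_cell x i) = Halt"
  shows "logspace_computable f"
  unfolding logspace_computable_def
proof (rule exI[of _ machine], rule exI[of _ 4], intro conjI allI is_tm_machine)
  fix x :: "'a list"
  obtain S where S: "\<And>l. 2 ^ l \<le> 2 * Suc (length x) \<Longrightarrow> l < S" "real S \<le> 4 * log 2 (real (length x) + 2)"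
    using logspace_bound by blast
  obtain q i cs where r: "(cstep prog x (Suc (length x)))\<^sup>*\<^sup>* (q0, 0, replicate r 0, []) (q, i, cs, f x)"
    and hlt: "prog q (in_cell x i) = Halt"
    using assms by blast
  then obtain dss where q: "q \<in> Q"
    and reach: "(mstep x S)\<^sup>*\<^sup>* (init_config machine) (conf (st q 0) i (tapes dss) (f x))"
    using simulate[OF r S(1)] by auto
  have "halted machine x (conf (st q 0) i (tapes dss) (f x))"
    using q hlt by (simp add: halted_def next_action_def machine_def delta_halt)
  note * = mstep_run[OF reach this]
  show "\<exists>t. halted machine x (run machine x t) \<and> cfg_output (run machine x t) = f x"
    using * \<open>halted machine x _\<close> by (metis select_convs(4))
  show "\<forall>(i, _) \<in> set (cfg_tapes (run machine x t)). real i \<le> 4 * log 2 (real (length x) + 2)" for t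
    using * S(2) by (fastforce simp: in_space_def)
qed

end

theorem counter_machine_logspace:
  fixes prog :: "'q \<Rightarrow> 'a :: finite cell \<Rightarrow> ('q, 'a) instr"
  assumes "finite Q" "q0 \<in> Q"
    and "\<And>q c. q \<in> Q \<Longrightarrow> targets (prog q c) \<subseteq> Q"
    and "\<And>q c. q \<in> Q \<Longrightarrow> counters (prog q c) \<subseteq> {..<r}"
    and "\<And>x. \<exists>q i cs. (cstep prog x (Suc (length x)))\<^sup>*\<^sup>* (q0, 0, replicate r 0, []) (q, i, cs, f x) \<and>
      prog q (in_cell x i) = Halt"
  shows "logspace_computable f"
proof -
  obtain g where g: "bij_betw g Q {..<card Q}"
    using ex_bij_betw_finite_nat[OF assms(1)] by (auto simp: atLeast0LessThan)
  have "g q0 \<in> {..<card Q}" "0 \<in> {..<card Q}"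
    using g assms(1,2) by (auto simp: bij_betw_def card_gt_0_iff)
  \<comment> \<open>The initial state of a machine is number 0; exchanging 0 with the number of
    \<open>q0\<close> in the enumeration \<open>g\<close> achieves this, and the exchange is its own
    inverse.\<close>
  define \<tau> where "\<tau> = (\<lambda>i. if i = 0 then g q0 else if i = g q0 then 0 else i)"
  have "bij_betw \<tau> {..<card Q} {..<card Q}"
    using \<open>g q0 \<in> _\<close> \<open>0 \<in> _\<close>
    by (intro bij_betw_byWitness[where f' = \<tau>]) (auto simp: \<tau>_def)
  then have "bij_betw (\<tau> \<circ> g) Q {..<card Q}"
    using g by (rule bij_betw_trans[rotated])
  then interpret counter_machine prog r Q q0 "\<tau> \<circ> g"
    using assms by unfold_locales (auto simp: \<tau>_def)
  show ?thesis
    using assms(5) by (rule logspace_computable)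
qed


section \<open>The transducer\<close>

text \<open>The phases of reading an instance: the number of propositions, a boundary between models
  (\<open>s\<close> tells whether these are the negative ones), inside a letter, after a letter (\<open>v\<close> tells whether
  it belongs to the period), after the separator of prefix and period (\<open>f\<close> tells whether the
  prefix is nonempty), the size bound, and the end.\<close>

datatype phase = RP | RS bool | RL bool bool | RA bool bool | RB bool bool | RN | RE

definition letter_phase :: "bool \<Rightarrow> bool \<Rightarrow> sym \<Rightarrow> phase option" where
  "letter_phase s v y =
     (if y = Dot then Some (RA s v) else if y \<in> {Zero, One} then Some (RL s v) else None)"

text \<open>Only a letter can follow \<open>RB\<close>, so the period is nonempty.
  \<open>Bar\<close> is refused inside the period and \<open>Semi\<close> inside the prefix, so each
  word has exactly one separator.\<close>

fun next_phase :: "phase \<Rightarrow> sym \<Rightarrow> phase option" where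
  "next_phase RP y = (if y = Tick then Some RP else if y = Dot then Some (RS False) else None)"
| "next_phase (RS s) y =
     (if y = Hash then Some (if s then RN else RS True)
      else if y = Bar then Some (RB s False) else letter_phase s False y)"
| "next_phase (RL s v) y = letter_phase s v y"
| "next_phase (RA s v) y =
     (if y = Bar then (if v then None else Some (RB s True))
      else if y = Semi then (if v then Some (RS s) else None) else letter_phase s v y)"
| "next_phase (RB s f) y = letter_phase s True y"
| "next_phase RN y = (if y = Tick then Some RN else if y = Dot then Some RE else None)"
| "next_phase RE y = None"

text \<open>The counters \<open>a\<close> and \<open>c\<close> hold the number of letters read so far in the current word and in its
  prefix. The successor of a state is written only when the next symbol shows whether the state is
  the last one.\<close>

fun incs_a :: "phase \<Rightarrow> bool" where
  "incs_a RP = False" | "incs_a RN = False" | "incs_a RE = False" | "incs_a _ = True"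

fun incs_c :: "phase \<Rightarrow> bool" where
  "incs_c (RS s) = True" | "incs_c (RL s v) = (\<not> v)" | "incs_c (RA s v) = (\<not> v)" | "incs_c _ = False"

definition next_a :: "phase \<Rightarrow> sym \<Rightarrow> nat \<Rightarrow> nat" where
  "next_a ph y a = (if y = Semi then 0 else if y = Dot \<and> incs_a ph then Suc a else a)"

definition next_c :: "phase \<Rightarrow> sym \<Rightarrow> nat \<Rightarrow> nat" where
  "next_c ph y c = (if y = Semi then 0 else if y = Dot \<and> incs_c ph then Suc c else c)"

text \<open>\<open>pre\<close> is written between the label and the successor of every state. It is empty for Kripke
  structures and lists the numbers of actions of the agents, all 1, for game structures.\<close>

definition emit_letter :: "sym list \<Rightarrow> sym \<Rightarrow> sym list" where
  "emit_letter pre y = y # (if y = Dot then pre else [])"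

text \<open>Closes the current state and opens the next one: after the target come its terminator,
  the terminator of the state and the flag of a non-initial state.\<close>

definition emit_succ :: "nat \<Rightarrow> sym list" where
  "emit_succ a = replicate a Tick @ [Dot, Bar, Zero]"

text \<open>After \<open>a\<close> letters the open state is number \<open>a - 1\<close> and its
  successor is \<open>a\<close>. At \<open>Semi\<close> the last state gets the back edge to
  \<open>c\<close>, the first position of the period. The separator of the word leaves no trace in
  the output, so \<open>f\<close> must tell whether a state is open when the period starts.\<close>

fun emit_sym :: "sym list \<Rightarrow> phase \<Rightarrow> sym \<Rightarrow> nat \<Rightarrow> nat \<Rightarrow> sym list" where
  "emit_sym pre (RS s) y a c =
     (if y = Hash then [Hash] else if y = Bar then [] else One # emit_letter pre y)"
| "emit_sym pre (RL s v) y a c = emit_letter pre y"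
| "emit_sym pre (RA s v) y a c =
     (if y = Bar then [] else if y = Semi then replicate c Tick @ [Dot, Bar, Semi]
      else emit_succ a @ emit_letter pre y)"
| "emit_sym pre (RB s f) y a c = (if f then emit_succ a else [One]) @ emit_letter pre y"
| "emit_sym pre _ y a c = [y]"

text \<open>A run that fails ends its output with \<open>Zero\<close>, which is not the end of any instance.\<close>

primrec translate :: "sym list \<Rightarrow> sym list \<Rightarrow> phase \<Rightarrow> nat \<Rightarrow> nat \<Rightarrow> sym list" where
  "translate pre [] ph a c = (if ph = RE then [] else [Zero])"
| "translate pre (y # ys) ph a c =
     (case next_phase ph y of None \<Rightarrow> [Zero]
      | Some ph' \<Rightarrow> emit_sym pre ph y a c @ translate pre ys ph' (next_a ph y a) (next_c ph y c))"


subsection \<open>Its implementation by a counter machine\<close>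

text \<open>Writing a counter in unary destroys it. \<open>Move\<close> and \<open>Restore\<close>
  save \<open>a\<close>, which later letters need again; \<open>Dump\<close> and
  \<open>Reset\<close> let \<open>c\<close> and \<open>a\<close> go to 0, where they must be for the
  next word.\<close>

datatype ctl =
    Start | Stop | Read phase | Advance phase | IncA bool bool | IncC bool
  | Move phase | Move_Step phase | Restore phase | Restore_Step phase
  | Dump bool | Reset bool

text \<open>A state consists of a string that is still to be written and of what to do afterwards. Counters
  0 and 2 are \<open>a\<close> and \<open>c\<close>; counter 1 keeps \<open>a\<close> while it is written out.\<close>

fun read_instr :: "sym list \<Rightarrow> phase \<Rightarrow> sym \<Rightarrow> sym list \<times> ctl" where
  "read_instr pre (RS s) y =
     (if y = Hash then ([Hash], Advance (if s then RN else RS True))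
      else if y = Bar then ([], Advance (RB s False)) else ([One], Read (RL s False)))"
| "read_instr pre (RL s v) y =
     (if y = Dot then (Dot # pre, IncA s v) else ([y], Advance (RL s v)))"
| "read_instr pre (RA s v) y =
     (if y = Bar then ([], Advance (RB s True))
      else if y = Semi then ([], Dump s) else ([], Move (RL s v)))"
| "read_instr pre (RB s f) y =
     (if f then ([], Move (RL s True)) else ([One], Read (RL s True)))"
| "read_instr pre ph y = ([y], Advance (the (next_phase ph y)))"

fun instr_of :: "sym list \<Rightarrow> ctl \<Rightarrow> sym cell \<Rightarrow> (sym list \<times> ctl, sym) instr" where
  "instr_of pre Start z = Jump MoveRight ([], Read RP)"
| "instr_of pre Stop z = Halt"
| "instr_of pre (Read ph) z =
     (case z of
        LeftEnd \<Rightarrow> Halt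
      | RightEnd \<Rightarrow> if ph = RE then Halt else Jump Stay ([Zero], Stop)
      | Sym y \<Rightarrow>
          if next_phase ph y = None then Jump Stay ([Zero], Stop)
          else Jump Stay (read_instr pre ph y))"
| "instr_of pre (Advance ph) z = Jump MoveRight ([], Read ph)"
| "instr_of pre (IncA s v) z = Inc 0 ([], if v then Advance (RA s v) else IncC s)"
| "instr_of pre (IncC s) z = Inc 2 ([], Advance (RA s False))"
| "instr_of pre (Move ph) z = Dec 0 ([], Restore ph) ([], Move_Step ph)"
| "instr_of pre (Move_Step ph) z = Inc 1 ([Tick], Move ph)"
| "instr_of pre (Restore ph) z = Dec 1 ([Dot, Bar, Zero], Read ph) ([], Restore_Step ph)"
| "instr_of pre (Restore_Step ph) z = Inc 0 ([], Restore ph)"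
| "instr_of pre (Dump s) z = Dec 2 ([], Reset s) ([Tick], Dump s)"
| "instr_of pre (Reset s) z = Dec 0 ([Dot, Bar, Semi], Advance (RS s)) ([], Reset s)"

fun prog :: "sym list \<Rightarrow> sym list \<times> ctl \<Rightarrow> sym cell \<Rightarrow> (sym list \<times> ctl, sym) instr" where
  "prog pre (y # w, q) z = Emit y (w, q)"
| "prog pre ([], q) z = instr_of pre q z"

section \<open>Finiteness of the control\<close>

lemma finite_phase: "finite (UNIV :: phase set)"
proof -
  have "UNIV = {RP, RN, RE} \<union> range RS \<union> range (case_prod RL) \<union> range (case_prod RA) \<union> range (case_prod RB)"
    (is "_ = ?R")
  proof -
    have "ph \<in> ?R" for ph
      by (cases ph) (auto simp: image_iff)
    then show ?thesis by blast
  qed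
  moreover have "finite ?R"
    by (intro finite_UnI finite_imageI) auto
  ultimately show ?thesis
    by metis
qed

lemma finite_ctl: "finite (UNIV :: ctl set)"
proof -
  have "UNIV = {Start, Stop} \<union> range Read \<union> range Advance \<union> range (case_prod IncA) \<union> range IncC \<union>
    range Move \<union> range Move_Step \<union> range Restore \<union> range Restore_Step \<union> range Dump \<union> range Reset"
    (is "_ = ?R")
  proof -
    have "q \<in> ?R" for q
      by (cases q) (auto simp: image_iff)
    then show ?thesis by blast
  qed
  moreover have "finite ?R"
    using finite_phase by (intro finite_UnI finite_imageI) auto
  ultimately show ?thesis
    by metis
qed

section \<open>Correctness of the program\<close>

context
  fixes pre :: "sym list" and x :: "sym list"
begin

abbreviation reaches ::
  "(sym list \<times> ctl) \<times> nat \<times> nat list \<times> sym list \<Rightarrow>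
   (sym list \<times> ctl) \<times> nat \<times> nat list \<times> sym list \<Rightarrow> bool"  (infix "\<leadsto>" 50) where
  "C \<leadsto> C' \<equiv> (cstep (prog pre) x (Suc (length x)))\<^sup>*\<^sup>* C C'"

text \<open>This rule and the following ones work backwards, from a run after the instruction to a
  run before it, so that the program is verified by chaining them from the goal.\<close>

lemma reaches_jump:
  assumes "prog pre q (in_cell x i) = Jump d q'" "(q', min (move d i) (length x + 1), cs, out) \<leadsto> C"
  shows "(q, i, cs, out) \<leadsto> C"
  by (rule converse_rtranclp_into_rtranclp[OF cstep.jump[where prog = "prog pre", OF assms(1)] assms(2)])

lemma reaches_inc:
  assumes "prog pre q (in_cell x i) = Inc j q'" "cs ! j \<le> length x"
    "(q', i, cs[j := Suc (cs ! j)], out) \<leadsto> C"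
  shows "(q, i, cs, out) \<leadsto> C"
  by (rule converse_rtranclp_into_rtranclp[OF cstep.inc[where prog = "prog pre", OF assms(1)] assms(3)])
    (use assms(2) in simp)

lemma reaches_dec_zero:
  assumes "prog pre q (in_cell x i) = Dec j q' q''" "cs ! j = 0" "(q', i, cs, out) \<leadsto> C"
  shows "(q, i, cs, out) \<leadsto> C"
  by (rule converse_rtranclp_into_rtranclp[OF cstep.dec_zero[where prog = "prog pre", OF assms(1,2)] assms(3)])

lemma reaches_dec_pos:
  assumes "prog pre q (in_cell x i) = Dec j q' q''" "cs ! j > 0"
    "(q'', i, cs[j := cs ! j - 1], out) \<leadsto> C"
  shows "(q, i, cs, out) \<leadsto> C"
  by (rule converse_rtranclp_into_rtranclp[OF cstep.dec_pos[where prog = "prog pre", OF assms(1,2)] assms(3)])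

text \<open>Not for the empty string, on which the rule would not terminate.\<close>

lemma reaches_emit:
  assumes "(([], q), i, cs, out @ y # w) \<leadsto> C"
  shows "((y # w, q), i, cs, out) \<leadsto> C"
  using assms
proof (induction w arbitrary: y out)
  case Nil
  then show ?case
    by - (rule converse_rtranclp_into_rtranclp[where r = "cstep (prog pre) x (Suc (length x))"],
      rule cstep.emit, simp_all)
next
  case (Cons z w)
  then have "((z # w, q), i, cs, out @ [y]) \<leadsto> C"
    by simp
  then show ?case
    by - (rule converse_rtranclp_into_rtranclp[where r = "cstep (prog pre) x (Suc (length x))"],
      rule cstep.emit, simp_all)
qed

lemma run_IncA:
  assumes "(([], if v then Advance (RA s v) else IncC s), i, [Suc a, b, c], out) \<leadsto> C" "a \<le> length x"
  shows "(([], IncA s v), i, [a, b, c], out) \<leadsto> C"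
  by (rule reaches_inc[where j = 0]) (use assms in simp_all)

lemma run_IncC:
  assumes "(([], Advance (RA s False)), i, [a, b, Suc c], out) \<leadsto> C" "c \<le> length x"
  shows "(([], IncC s), i, [a, b, c], out) \<leadsto> C"
  by (rule reaches_inc[where j = 2]) (use assms in simp_all)

lemma run_Move_0:
  assumes "(([], Restore ph), i, [0, b, c], out) \<leadsto> C"
  shows "(([], Move ph), i, [0, b, c], out) \<leadsto> C"
  by (rule reaches_dec_zero[where j = 0]) (use assms in simp_all)

lemma run_Move_Suc:
  assumes "(([Tick], Move ph), i, [a, Suc b, c], out) \<leadsto> C" "b \<le> length x"
  shows "(([], Move ph), i, [Suc a, b, c], out) \<leadsto> C"
proof -
  have "(([], Move_Step ph), i, [a, b, c], out) \<leadsto> C"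
    by (rule reaches_inc[where j = 1]) (use assms in simp_all)
  then show ?thesis
    by - (rule reaches_dec_pos[where j = 0], simp_all)
qed

lemma run_Restore_0:
  assumes "(([Dot, Bar, Zero], Read ph), i, [a, 0, c], out) \<leadsto> C"
  shows "(([], Restore ph), i, [a, 0, c], out) \<leadsto> C"
  by (rule reaches_dec_zero[where j = 1]) (use assms in simp_all)

lemma run_Restore_Suc:
  assumes "(([], Restore ph), i, [Suc a, b, c], out) \<leadsto> C" "a \<le> length x"
  shows "(([], Restore ph), i, [a, Suc b, c], out) \<leadsto> C"
proof -
  have "(([], Restore_Step ph), i, [a, b, c], out) \<leadsto> C"
    by (rule reaches_inc[where j = 0]) (use assms in simp_all)
  then show ?thesis
    by - (rule reaches_dec_pos[where j = 1], simp_all)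
qed

lemma run_Dump_0:
  assumes "(([], Reset s), i, [a, b, 0], out) \<leadsto> C"
  shows "(([], Dump s), i, [a, b, 0], out) \<leadsto> C"
  by (rule reaches_dec_zero[where j = 2]) (use assms in simp_all)

lemma run_Dump_Suc:
  assumes "(([Tick], Dump s), i, [a, b, c], out) \<leadsto> C"
  shows "(([], Dump s), i, [a, b, Suc c], out) \<leadsto> C"
  by (rule reaches_dec_pos[where j = 2]) (use assms in simp_all)

lemma run_Reset_0:
  assumes "(([Dot, Bar, Semi], Advance (RS s)), i, [0, b, c], out) \<leadsto> C"
  shows "(([], Reset s), i, [0, b, c], out) \<leadsto> C"
  by (rule reaches_dec_zero[where j = 0]) (use assms in simp_all)

lemma run_Reset_Suc:
  assumes "(([], Reset s), i, [a, b, c], out) \<leadsto> C"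
  shows "(([], Reset s), i, [Suc a, b, c], out) \<leadsto> C"
  by (rule reaches_dec_pos[where j = 0]) (use assms in simp_all)

text \<open>The loops of \<open>Move\<close> and \<open>Restore\<close> both preserve the sum of
  counters 0 and 1, so a bound on the sum licenses every increment.\<close>

lemma run_Restore:
  assumes "a + b \<le> length x" "(([Dot, Bar, Zero], Read ph), i, [a + b, 0, c], out) \<leadsto> C"
  shows "(([], Restore ph), i, [a, b, c], out) \<leadsto> C"
  using assms
proof (induction b arbitrary: a)
  case 0
  then show ?case
    by (simp add: run_Restore_0)
next
  case (Suc b)
  then show ?case
    by (simp add: run_Restore_Suc)
qed

lemma run_Move:
  assumes "a + b \<le> length x"
    "(([], Read ph), i, [a + b, 0, c], out @ emit_succ a) \<leadsto> C"
  shows "(([], Move ph), i, [a, b, c], out) \<leadsto> C"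
  using assms
proof (induction a arbitrary: b out)
  case 0
  then have "(([Dot, Bar, Zero], Read ph), i, [0 + b, 0, c], out) \<leadsto> C"
    by (intro reaches_emit) (simp add: emit_succ_def)
  with 0 show ?case
    by (intro run_Move_0 run_Restore) simp_all
next
  case (Suc a)
  have "(([], Move ph), i, [a, Suc b, c], out @ [Tick]) \<leadsto> C"
    by (rule Suc.IH) (use Suc.prems in \<open>simp_all add: emit_succ_def\<close>)
  with Suc.prems(1) show ?case
    by (intro run_Move_Suc reaches_emit) simp_all
qed

lemma run_Reset:
  assumes "(([Dot, Bar, Semi], Advance (RS s)), i, [0, b, c], out) \<leadsto> C"
  shows "(([], Reset s), i, [a, b, c], out) \<leadsto> C"
  using assms by (induction a) (auto intro: run_Reset_0 run_Reset_Suc)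

lemma run_Dump:
  assumes "(([], Advance (RS s)), i, [0, b, 0], out @ replicate c Tick @ [Dot, Bar, Semi]) \<leadsto> C"
  shows "(([], Dump s), i, [a, b, c], out) \<leadsto> C"
  using assms
proof (induction c arbitrary: out)
  case 0
  then show ?case
    by (intro run_Dump_0 run_Reset reaches_emit) simp
next
  case (Suc c)
  then have "(([], Dump s), i, [a, b, c], out @ [Tick]) \<leadsto> C"
    by simp
  then show ?case
    by (intro run_Dump_Suc reaches_emit)
qed

lemma run_Advance:
  assumes "(([], Read ph), Suc i, cs, out) \<leadsto> C" "i \<le> length x"
  shows "(([], Advance ph), i, cs, out) \<leadsto> C"
  by (rule reaches_jump[where d = MoveRight]) (use assms in \<open>simp_all add: min_def\<close>)

lemma run_Read:
  assumes "in_cell x i = Sym y" "next_phase ph y = Some ph'" "i \<le> length x"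
    "(read_instr pre ph y, i, cs, out) \<leadsto> C"
  shows "(([], Read ph), i, cs, out) \<leadsto> C"
  by (rule reaches_jump[where d = Stay and q' = "read_instr pre ph y"])
    (use assms in \<open>simp_all add: min_def\<close>)

text \<open>Every counted letter has a terminator to the left of the head, so \<open>a\<close> and
  \<open>c\<close> stay below the head position; this licenses the increments at
  \<open>Dot\<close>.\<close>

lemma run_letter:
  assumes y: "in_cell x i = Sym y" and ph: "letter_phase s v y = Some ph'" and i: "i \<le> length x"
    and le: "a < i" "c < i"
    and C: "(([], Read ph'), Suc i, [next_a (RL s v) y a, 0, next_c (RL s v) y c],
      out @ emit_letter pre y) \<leadsto> C"
  shows "(([], Read (RL s v)), i, [a, 0, c], out) \<leadsto> C"
proof (rule run_Read[OF y _ i])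
  show "next_phase (RL s v) y = Some ph'"
    using ph by simp
  show "(read_instr pre (RL s v) y, i, [a, 0, c], out) \<leadsto> C"
  proof (cases "y = Dot")
    case True
    have adv: "(([], Advance (RA s v)), i, [next_a (RL s v) y a, 0, next_c (RL s v) y c],
        out @ Dot # pre) \<leadsto> C"
      using ph C i True by (intro run_Advance) (simp_all add: letter_phase_def emit_letter_def)
    have "(([], IncA s v), i, [a, 0, c], out @ Dot # pre) \<leadsto> C"
    proof (cases v)
      case True
      then show ?thesis
        using adv le i \<open>y = Dot\<close> by (intro run_IncA) (simp_all add: next_a_def next_c_def)
    next
      case False
      then have "(([], IncC s), i, [Suc a, 0, c], out @ Dot # pre) \<leadsto> C"
        using adv le i \<open>y = Dot\<close> by (intro run_IncC) (simp_all add: next_a_def next_c_def)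
      then show ?thesis
        using False le i by (intro run_IncA) simp_all
    qed
    then have "((Dot # pre, IncA s v), i, [a, 0, c], out) \<leadsto> C"
      by (rule reaches_emit)
    then show ?thesis
      using True by simp
  next
    case False
    then have "(([y], Advance (RL s v)), i, [a, 0, c], out) \<leadsto> C"
      using ph C i
      by (intro reaches_emit run_Advance)
        (auto simp: letter_phase_def next_a_def next_c_def emit_letter_def split: if_splits)
    then show ?thesis
      using False by simp
  qed
qed

lemma letter_phase_not_Semi: "letter_phase s v y = Some ph \<Longrightarrow> y \<noteq> Semi"
  by (auto simp: letter_phase_def)

text \<open>In \<open>RS\<close>, \<open>RA\<close> and \<open>RB\<close> the program first writes
  what has to precede the letter and then reads the same symbol again in phase \<open>RL\<close>,
  which leads to the same next phase and the same counter values; \<open>run_letter\<close> does the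
  rest.\<close>

lemma run_phase:
  assumes y: "in_cell x i = Sym y" and ph: "next_phase ph y = Some ph'" and i: "i \<le> length x"
    and le: "a < i" "c < i"
    and C: "(([], Read ph'), Suc i, [next_a ph y a, 0, next_c ph y c], out @ emit_sym pre ph y a c) \<leadsto> C"
  shows "(([], Read ph), i, [a, 0, c], out) \<leadsto> C"
proof (cases "\<exists>s v. ph = RL s v")
  case True
  then obtain s v where RL: "ph = RL s v"
    by blast
  show ?thesis
    unfolding RL by (rule run_letter[OF y _ i le, of s v ph']) (use ph C RL in simp_all)
next
  case not_RL: False
  show ?thesis
  proof (rule run_Read[OF y ph i], cases ph)
    case RP
    then have "(([y], Advance ph'), i, [a, 0, c], out) \<leadsto> C"
      using ph C i by (intro reaches_emit run_Advance) (auto simp: next_a_def next_c_def split: if_splits)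
    then show "(read_instr pre ph y, i, [a, 0, c], out) \<leadsto> C"
      using RP ph by simp
  next
    case RN
    then have "(([y], Advance ph'), i, [a, 0, c], out) \<leadsto> C"
      using ph C i by (intro reaches_emit run_Advance) (auto simp: next_a_def next_c_def split: if_splits)
    then show "(read_instr pre ph y, i, [a, 0, c], out) \<leadsto> C"
      using RN ph by simp
  next
    case RE
    then show "(read_instr pre ph y, i, [a, 0, c], out) \<leadsto> C"
      using ph by simp
  next
    case (RL s v)
    then show "(read_instr pre ph y, i, [a, 0, c], out) \<leadsto> C"
      using not_RL by simp
  next
    case (RS s)
    consider "y = Hash" | "y = Bar" | "letter_phase s False y = Some ph'" "y \<noteq> Hash" "y \<noteq> Bar"
      using ph RS by (cases "y = Hash"; cases "y = Bar") simp_all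
    then show "(read_instr pre ph y, i, [a, 0, c], out) \<leadsto> C"
    proof cases
      case 1
      then have ph': "ph' = (if s then RN else RS True)"
        using ph RS by simp
      with 1 have "(([Hash], Advance ph'), i, [a, 0, c], out) \<leadsto> C"
        using C[unfolded RS] i by (intro reaches_emit run_Advance) (simp_all add: next_a_def next_c_def)
      then show ?thesis
        using RS 1 ph' by simp
    next
      case 2
      then have ph': "ph' = RB s False"
        using ph RS by simp
      with 2 have "(([], Advance ph'), i, [a, 0, c], out) \<leadsto> C"
        using C[unfolded RS] i by (intro run_Advance) (simp_all add: next_a_def next_c_def)
      then show ?thesis
        using RS 2 ph' by simp
    next
      case 3
      then have "(([], Read (RL s False)), i, [a, 0, c], out @ [One]) \<leadsto> C"
        using C[unfolded RS] letter_phase_not_Semi by (intro run_letter[OF y _ i le]) (simp_all add: next_a_def next_c_def)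
      then have "(([One], Read (RL s False)), i, [a, 0, c], out) \<leadsto> C"
        by (rule reaches_emit)
      then show ?thesis
        using RS 3 by simp
    qed
  next
    case (RA s v)
    consider "y = Semi" "ph' = RS s" v | "y = Bar" "ph' = RB s True"
      | "letter_phase s v y = Some ph'" "y \<noteq> Semi" "y \<noteq> Bar"
      using ph RA by (auto split: if_splits)
    then show "(read_instr pre ph y, i, [a, 0, c], out) \<leadsto> C"
    proof cases
      case 1
      then have "(([], Dump s), i, [a, 0, c], out) \<leadsto> C"
        using C[unfolded RA] i by (intro run_Dump run_Advance) (simp_all add: next_a_def next_c_def)
      then show ?thesis
        using RA 1 by simp
    next
      case 2
      then have "(([], Advance ph'), i, [a, 0, c], out) \<leadsto> C"
        using C[unfolded RA] i by (intro run_Advance) (simp_all add: next_a_def next_c_def)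
      then show ?thesis
        using RA 2 by simp
    next
      case 3
      then have "(([], Read (RL s v)), i, [a + 0, 0, c], out @ emit_succ a) \<leadsto> C"
        using C[unfolded RA] le by (simp, intro run_letter[OF y _ i]) (simp_all add: next_a_def next_c_def)
      then have "(([], Move (RL s v)), i, [a, 0, c], out) \<leadsto> C"
        using i le by (intro run_Move) simp_all
      then show ?thesis
        using RA 3 by simp
    qed
  next
    case (RB s f)
    have *: "letter_phase s True y = Some ph'"
      using ph RB by simp
    note ns = letter_phase_not_Semi[OF *]
    show "(read_instr pre ph y, i, [a, 0, c], out) \<leadsto> C"
    proof (cases f)
      case True
      then have "(([], Read (RL s True)), i, [a + 0, 0, c], out @ emit_succ a) \<leadsto> C"
        using C[unfolded RB] le * ns by (simp, intro run_letter[OF y _ i]) (simp_all add: next_a_def next_c_def)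
      then have "(([], Move (RL s True)), i, [a, 0, c], out) \<leadsto> C"
        using i le by (intro run_Move) simp_all
      then show ?thesis
        using RB True by simp
    next
      case False
      then have "(([], Read (RL s True)), i, [a, 0, c], out @ [One]) \<leadsto> C"
        using C[unfolded RB] * ns by (intro run_letter[OF y _ i le]) (simp_all add: next_a_def next_c_def)
      then have "(([One], Read (RL s True)), i, [a, 0, c], out) \<leadsto> C"
        by (rule reaches_emit)
      then show ?thesis
        using RB False by simp
    qed
  qed
qed

lemma run_fail:
  assumes "prog pre q (in_cell x i) = Jump Stay ([Zero], Stop)"
  shows "\<exists>q' i' cs'. (q, i, cs, out) \<leadsto> (q', i', cs', out @ [Zero]) \<and> prog pre q' (in_cell x i') = Halt"
proof -
  have "(([Zero], Stop), min (move Stay i) (length x + 1), cs, out) \<leadsto>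
      (([], Stop), min (move Stay i) (length x + 1), cs, out @ [Zero])"
    by (rule reaches_emit) (rule rtranclp.rtrancl_refl)
  with assms have "(q, i, cs, out) \<leadsto> (([], Stop), min (move Stay i) (length x + 1), cs, out @ [Zero])"
    by (rule reaches_jump)
  moreover have "prog pre ([], Stop) (in_cell x (min (move Stay i) (length x + 1))) = Halt"
    by simp
  ultimately show ?thesis
    by blast
qed

lemma reaches_translate:
  assumes "x = ys @ zs" "a \<le> length ys" "c \<le> length ys"
  shows "\<exists>q i cs. (([], Read ph), Suc (length ys), [a, 0, c], out) \<leadsto> (q, i, cs, out @ translate pre zs ph a c) \<and>
    prog pre q (in_cell x i) = Halt"
  using assms
proof (induction zs arbitrary: ys ph a c out)
  case Nil
  then have cell: "in_cell x (Suc (length ys)) = RightEnd"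
    by (simp add: in_cell_def)
  show ?case
  proof (cases "ph = RE")
    case True
    have "prog pre ([], Read ph) (in_cell x (Suc (length ys))) = Halt"
      using True cell by simp
    then show ?thesis
      using True by (intro exI[of _ "([], Read ph)"] exI[of _ "Suc (length ys)"] exI[of _ "[a, 0, c]"]) simp
  next
    case False
    then show ?thesis
      using run_fail[of "([], Read ph)" "Suc (length ys)" "[a, 0, c]" out] cell by simp
  qed
next
  case (Cons z zs)
  have cell: "in_cell x (Suc (length ys)) = Sym z"
    using Cons.prems by (simp add: in_cell_def nth_append)
  show ?case
  proof (cases "next_phase ph z")
    case None
    then show ?thesis
      using run_fail[of "([], Read ph)" "Suc (length ys)" "[a, 0, c]" out] cell by simp
  next
    case (Some ph')
    let ?out = "out @ emit_sym pre ph z a c" and ?ys = "ys @ [z]"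
    have "\<exists>q i cs. (([], Read ph'), Suc (length ?ys), [next_a ph z a, 0, next_c ph z c], ?out) \<leadsto>
        (q, i, cs, ?out @ translate pre zs ph' (next_a ph z a) (next_c ph z c)) \<and>
      prog pre q (in_cell x i) = Halt"
      using Cons.prems by (intro Cons.IH) (auto simp: next_a_def next_c_def)
    then obtain q i cs where
      "(([], Read ph'), Suc (Suc (length ys)), [next_a ph z a, 0, next_c ph z c], ?out) \<leadsto>
        (q, i, cs, ?out @ translate pre zs ph' (next_a ph z a) (next_c ph z c))"
      "prog pre q (in_cell x i) = Halt"
      by auto
    moreover from this(1) have "(([], Read ph), Suc (length ys), [a, 0, c], out) \<leadsto>
        (q, i, cs, ?out @ translate pre zs ph' (next_a ph z a) (next_c ph z c))"
      using Cons.prems by (intro run_phase[OF cell Some]) simp_all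
    ultimately show ?thesis
      using Some by (intro exI[of _ q] exI[of _ i] exI[of _ cs]) simp
  qed
qed

lemma reaches_result:
  "\<exists>q i cs. (([], Start), 0, replicate 3 0, []) \<leadsto> (q, i, cs, translate pre x RP 0 0) \<and>
    prog pre q (in_cell x i) = Halt"
proof -
  obtain q i cs where
    "(([], Read RP), 1, [0, 0, 0], []) \<leadsto> (q, i, cs, translate pre x RP 0 0)"
    "prog pre q (in_cell x i) = Halt"
    using reaches_translate[of "[]" x 0 0 RP "[]"] by auto
  moreover from this(1) have "(([], Start), 0, [0, 0, 0], []) \<leadsto> (q, i, cs, translate pre x RP 0 0)"
    by - (rule reaches_jump[where d = MoveRight and q' = "([], Read RP)"], simp_all)
  ultimately show ?thesis
    by (intro exI[of _ q] exI[of _ i] exI[of _ cs]) (simp add: numeral_3_eq_3)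
qed

end

theorem translate_logspace: "logspace_computable (\<lambda>x. translate pre x RP 0 0)"
proof (rule counter_machine_logspace)
  \<comment> \<open>The longest strings put into a state are \<open>Dot # pre\<close> and endings of
    three symbols such as \<open>[Dot, Bar, Zero]\<close>; emitting only shortens them.\<close>
  let ?Q = "{w :: sym list. length w \<le> length pre + 3} \<times> (UNIV :: ctl set)"
  show "finite ?Q"
    using finite_lists_length_le[of "UNIV :: sym set" "length pre + 3"] finite_ctl
    by (auto intro!: finite_cartesian_product)
  show "([], Start) \<in> ?Q"
    by simp
  have len: "length (fst (read_instr pre ph y)) \<le> length pre + 3" for ph y
    by (cases ph) auto
  show "targets (prog pre q z) \<subseteq> ?Q" if "q \<in> ?Q" for q z
  proof -
    obtain w p where q: "q = (w, p)"
      by (cases q)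
    show ?thesis
    proof (cases w)
      case Nil
      then show ?thesis
        using q len by (cases p) (auto split: cell.splits simp: mem_Times_iff)
    qed (use that q in auto)
  qed
  show "counters (prog pre q z) \<subseteq> {..<3}" if "q \<in> ?Q" for q z
  proof -
    obtain w p where q: "q = (w, p)"
      by (cases q)
    show ?thesis
    proof (cases w)
      case Nil
      then show ?thesis
        using q by (cases p) (auto split: cell.splits)
    qed (use q in auto)
  qed
qed (rule reaches_result)


section \<open>Parsing\<close>

text \<open>Stronger than injectivity: the remainder of the string is determined as well, so codes
  can be concatenated and parsed from left to right.\<close>

definition prefix_code :: "('b \<Rightarrow> 'c list) \<Rightarrow> bool" where
  "prefix_code f \<longleftrightarrow> (\<forall>x y r s. f x @ r = f y @ s \<longrightarrow> x = y \<and> r = s)"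

lemma prefix_codeD: "prefix_code f \<Longrightarrow> f x @ r = f y @ s \<Longrightarrow> x = y \<and> r = s"
  unfolding prefix_code_def by blast

text \<open>The next symbol decides whether another item follows, because no code word starts with
  the terminator.\<close>

lemma prefix_code_list:
  assumes f: "prefix_code f" and t: "\<And>x. \<exists>y ys. f x = y # ys \<and> y \<noteq> t"
  shows "prefix_code (\<lambda>xs. concat (map f xs) @ [t])"
proof -
  have "xs = ys \<and> r = s" if "concat (map f xs) @ t # r = concat (map f ys) @ t # s" for xs ys r s
    using that
  proof (induction xs arbitrary: ys)
    case Nil
    show ?case
    proof (cases ys)
      case (Cons y ys')
      then show ?thesis
        using Nil t[of y] by auto
    qed (use Nil in simp)
  next
    case (Cons x xs)
    show ?case
    proof (cases ys)
      case Nil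
      then show ?thesis
        using Cons.prems t[of x] by auto
    next
      case ys: (Cons y ys')
      then have "f x @ (concat (map f xs) @ t # r) = f y @ (concat (map f ys') @ t # s)"
        using Cons.prems by simp
      then have "x = y" "concat (map f xs) @ t # r = concat (map f ys') @ t # s"
        using prefix_codeD[OF f] by blast+
      then show ?thesis
        using Cons.IH ys by blast
    qed
  qed
  then show ?thesis
    unfolding prefix_code_def by simp
qed

lemma prefix_code_num: "prefix_code enc_num"
proof -
  have "m = n \<and> r = s" if "replicate m Tick @ Dot # r = replicate n Tick @ Dot # s" for m n r s
    using that
  proof (induction m arbitrary: n)
    case 0
    then show ?case
      by (cases n) simp_all
  next
    case (Suc m)
    show ?case
    proof (cases n)
      case 0
      then show ?thesis
        using Suc.prems by simp
    next
      case n: (Suc k)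
      then have "replicate m Tick @ Dot # r = replicate k Tick @ Dot # s"
        using Suc.prems by simp
      from Suc.IH[OF this] show ?thesis
        using n by simp
    qed
  qed
  then show ?thesis
    unfolding prefix_code_def enc_num_def append_assoc append_Cons append_Nil by blast
qed

text \<open>Raw models keep the letters as bit strings of any length, so that the translation also covers
  inputs in which some letter has the wrong length; it preserves this defect.\<close>

type_synonym raw_word = "bool list list \<times> bool list list"
type_synonym raw_state = "bool \<times> bool list \<times> nat list"

definition enc_bits :: "bool list \<Rightarrow> sym list" where
  "enc_bits l = map enc_bit l @ [Dot]"

abbreviation enc_letters :: "bool list list \<Rightarrow> sym list" where
  "enc_letters ls \<equiv> concat (map enc_bits ls)"

fun enc_raw_word :: "raw_word \<Rightarrow> sym list" where
  "enc_raw_word (u, v) = enc_letters u @ [Bar] @ enc_letters v @ [Semi]"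

fun enc_raw_state :: "raw_state \<Rightarrow> sym list" where
  "enc_raw_state (b, l, ns) = enc_bit b # enc_bits l @ concat (map enc_num ns) @ [Bar]"

definition enc_raw_model :: "raw_state list \<Rightarrow> sym list" where
  "enc_raw_model ss = concat (map enc_raw_state ss) @ [Semi]"

section \<open>Unique parsing of raw encodings\<close>

lemma enc_bit_simps [simp]:
  "enc_bit b \<noteq> Dot" "enc_bit b \<noteq> Bar" "enc_bit b \<noteq> Semi" "enc_bit b \<noteq> Hash" "enc_bit b \<noteq> Tick"
  "enc_bit b = Zero \<or> enc_bit b = One" "enc_bit b = enc_bit b' \<longleftrightarrow> b = b'"
  by (simp_all add: enc_bit_def)

lemma prefix_code_bits: "prefix_code enc_bits"
proof -
  have "l = l' \<and> r = s" if "map enc_bit l @ Dot # r = map enc_bit l' @ Dot # s" for l l' r s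
    using that
  proof (induction l arbitrary: l')
    case Nil
    show ?case
    proof (cases l')
      case (Cons b m)
      then have "Dot = enc_bit b"
        using Nil by simp
      then show ?thesis
        by (simp add: enc_bit_def split: if_splits)
    qed (use Nil in simp)
  next
    case (Cons b l)
    show ?case
    proof (cases l')
      case Nil
      then show ?thesis
        using Cons.prems by simp
    next
      case l': (Cons b' m)
      then have "b = b'" "map enc_bit l @ Dot # r = map enc_bit m @ Dot # s"
        using Cons.prems by simp_all
      with Cons.IH[OF this(2)] show ?thesis
        using l' by simp
    qed
  qed
  then show ?thesis
    unfolding prefix_code_def enc_bits_def append_assoc append_Cons append_Nil by blast
qed

lemma prefix_code_raw_state: "prefix_code enc_raw_state"
proof -
  have nums: "prefix_code (\<lambda>ns. concat (map enc_num ns) @ [Bar])"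
  proof (rule prefix_code_list[OF prefix_code_num])
    show "\<exists>y ys. enc_num n = y # ys \<and> y \<noteq> Bar" for n
      by (cases n) (auto simp: enc_num_def)
  qed
  show ?thesis
    unfolding prefix_code_def
  proof (intro allI impI)
    fix p p' :: raw_state and r s
    obtain b l ns b' l' ns' where p: "p = (b, l, ns)" "p' = (b', l', ns')"
      by (cases p, cases p') auto
    assume "enc_raw_state p @ r = enc_raw_state p' @ s"
    then have b: "b = b'" and
      e: "enc_bits l @ ((concat (map enc_num ns) @ [Bar]) @ r) = enc_bits l' @ ((concat (map enc_num ns') @ [Bar]) @ s)"
      by (simp_all add: p)
    note e1 = prefix_codeD[OF prefix_code_bits e]
    from prefix_codeD[OF nums e1[THEN conjunct2]] e1 b show "p = p' \<and> r = s"
      by (simp add: p)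
  qed
qed

lemma prefix_code_raw_model: "prefix_code enc_raw_model"
proof -
  have "\<exists>y ys. enc_raw_state s = y # ys \<and> y \<noteq> Semi" for s
    by (cases s) auto
  from prefix_code_list[OF prefix_code_raw_state this] show ?thesis
    unfolding enc_raw_model_def by simp
qed

lemma enc_raw_sample_inject:
  assumes "enc_sample (\<lambda>_. enc_raw_model) p P N B = enc_sample (\<lambda>_. enc_raw_model) p' P' N' B'"
  shows "p = p' \<and> P = P' \<and> N = N' \<and> B = B'"
proof -
  have "\<exists>y ys. enc_raw_model ss = y # ys \<and> y \<noteq> Hash" for ss
    by (cases ss; cases "hd ss") (auto simp: enc_raw_model_def)
  note list = prefix_codeD[OF prefix_code_list[OF prefix_code_raw_model this]]
  note num = prefix_codeD[OF prefix_code_num]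
  \<comment> \<open>The encoding is regrouped into code words, each followed by a remainder; the
    final \<open>[]\<close> is the remainder after the last number.\<close>
  have e: "enc_num p @ ((concat (map enc_raw_model P) @ [Hash]) @ ((concat (map enc_raw_model N) @ [Hash]) @ (enc_num B @ []))) =
    enc_num p' @ ((concat (map enc_raw_model P') @ [Hash]) @ ((concat (map enc_raw_model N') @ [Hash]) @ (enc_num B' @ [])))"
    using assms by (simp add: enc_sample_def)
  note 1 = num[OF e]
  note 2 = list[OF 1[THEN conjunct2]]
  note 3 = list[OF 2[THEN conjunct2]]
  note 4 = num[OF 3[THEN conjunct2]]
  show ?thesis
    using 1 2 3 4 by (elim conjE) (intro conjI)
qed

lemma enc_sample_last: "\<exists>w. enc_sample enc p P N B = w @ [Dot]"
  by (simp add: enc_sample_def enc_num_def)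


subsection \<open>The inputs accepted by the transducer\<close>

primrec accepts :: "sym list \<Rightarrow> phase \<Rightarrow> bool" where
  "accepts [] ph \<longleftrightarrow> ph = RE"
| "accepts (y # ys) ph \<longleftrightarrow> (\<exists>ph'. next_phase ph y = Some ph' \<and> accepts ys ph')"

lemma translate_rejected: "\<not> accepts xs ph \<Longrightarrow> \<exists>w. translate pre xs ph a c = w @ [Zero]"
proof (induction xs arbitrary: ph a c)
  case (Cons y ys)
  show ?case
  proof (cases "next_phase ph y")
    case (Some ph')
    then obtain w where "translate pre ys ph' (next_a ph y a) (next_c ph y c) = w @ [Zero]"
      using Cons by fastforce
    then show ?thesis
      using Some by simp
  qed simp
qed simp

definition rest_lang :: "bool \<Rightarrow> sym list \<Rightarrow> bool" where
  "rest_lang s xs \<longleftrightarrow> (\<exists>P N B. (\<forall>w \<in> set P \<union> set N. snd w \<noteq> []) \<and>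
     xs = (if s then [] else concat (map enc_raw_word P) @ [Hash]) @
       concat (map enc_raw_word N) @ [Hash] @ enc_num B)"

definition period_lang :: "bool \<Rightarrow> bool list list \<Rightarrow> sym list \<Rightarrow> bool" where
  "period_lang s vs xs \<longleftrightarrow> (\<exists>ys. rest_lang s ys \<and> xs = enc_letters vs @ [Semi] @ ys)"

text \<open>The residual languages of the automaton: the suffixes that complete an input to the
  encoding of a sample with nonempty periods. What is left of a letter is again the code of a
  shorter letter, hence \<open>enc_bits\<close> in the case of \<open>RL\<close>.\<close>

fun phase_lang :: "phase \<Rightarrow> sym list \<Rightarrow> bool" where
  "phase_lang RP xs \<longleftrightarrow> (\<exists>p ys. rest_lang False ys \<and> xs = enc_num p @ ys)"
| "phase_lang (RS s) xs \<longleftrightarrow> rest_lang s xs"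
| "phase_lang (RA s v) xs \<longleftrightarrow>
     (if v then \<exists>vs. period_lang s vs xs
      else \<exists>us vs ys. vs \<noteq> [] \<and> period_lang s vs ys \<and> xs = enc_letters us @ [Bar] @ ys)"
| "phase_lang (RL s v) xs \<longleftrightarrow>
     (\<exists>l zs. xs = enc_bits l @ zs \<and> (if v then \<exists>vs. period_lang s vs zs
      else \<exists>us vs ys. vs \<noteq> [] \<and> period_lang s vs ys \<and> zs = enc_letters us @ [Bar] @ ys))"
| "phase_lang (RB s f) xs \<longleftrightarrow> (\<exists>vs. vs \<noteq> [] \<and> period_lang s vs xs)"
| "phase_lang RN xs \<longleftrightarrow> (\<exists>B. xs = enc_num B)"
| "phase_lang RE xs \<longleftrightarrow> xs = []"

lemma rest_lang_word:
  assumes "rest_lang s ys" "v \<noteq> []"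
  shows "rest_lang s (enc_raw_word (u, v) @ ys)"
proof -
  obtain P N B where *: "\<forall>w \<in> set P \<union> set N. snd w \<noteq> []"
    "ys = (if s then [] else concat (map enc_raw_word P) @ [Hash]) @
       concat (map enc_raw_word N) @ [Hash] @ enc_num B"
    using assms(1) unfolding rest_lang_def by blast
  show ?thesis
  proof (cases s)
    case True
    then show ?thesis
      unfolding rest_lang_def using * assms(2)
      by (intro exI[of _ P] exI[of _ "(u, v) # N"] exI[of _ B]) auto
  next
    case False
    then show ?thesis
      unfolding rest_lang_def using * assms(2)
      by (intro exI[of _ "(u, v) # P"] exI[of _ N] exI[of _ B]) auto
  qed
qed

lemma period_lang_Cons: "period_lang s vs zs \<Longrightarrow> period_lang s (l # vs) (enc_bits l @ zs)"
  unfolding period_lang_def by auto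

lemma phase_lang_letter:
  assumes "letter_phase s v y = Some ph'" "phase_lang ph' ys"
  shows "phase_lang (RL s v) (y # ys)"
proof (cases "y = Dot")
  case True
  then have "phase_lang (RA s v) ys" "y # ys = enc_bits [] @ ys"
    using assms by (simp_all add: letter_phase_def enc_bits_def)
  then show ?thesis
    unfolding phase_lang.simps by blast
next
  case False
  then have "ph' = RL s v" and y: "y = enc_bit (y = One)"
    using assms(1) by (auto simp: letter_phase_def enc_bit_def split: if_splits)
  with assms(2) obtain l zs where l: "ys = enc_bits l @ zs" "phase_lang (RA s v) zs"
    by auto
  have "y # ys = enc_bits ((y = One) # l) @ zs"
    using y l by (simp add: enc_bits_def)
  then show ?thesis
    using l(2) unfolding phase_lang.simps by blast
qed

text \<open>Where letters may still follow, the remainder of the current letter can count as one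
  more of them.\<close>

lemma phase_lang_RA:
  assumes "phase_lang (RL s v) xs"
  shows "phase_lang (RA s v) xs"
proof (cases v)
  case True
  with assms obtain l zs vs where "xs = enc_bits l @ zs" "period_lang s vs zs"
    by auto
  then have "period_lang s (l # vs) xs"
    by (simp add: period_lang_Cons)
  then show ?thesis
    using True by auto
next
  case False
  with assms obtain l us vs ys where "vs \<noteq> []" "period_lang s vs ys"
    "xs = enc_letters (l # us) @ [Bar] @ ys"
    by auto
  then have "\<exists>us vs ys. vs \<noteq> [] \<and> period_lang s vs ys \<and> xs = enc_letters us @ [Bar] @ ys"
    by blast
  then show ?thesis
    using False by simp
qed

lemma phase_lang_RB:
  assumes "phase_lang (RL s True) xs"
  shows "phase_lang (RB s f) xs"
proof -
  from assms obtain l zs vs where "xs = enc_bits l @ zs" "period_lang s vs zs"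
    by auto
  then have "period_lang s (l # vs) xs"
    by (simp add: period_lang_Cons)
  then have "\<exists>vs. vs \<noteq> [] \<and> period_lang s vs xs"
    by blast
  then show ?thesis
    by simp
qed

lemma rest_lang_Bar:
  assumes "vs \<noteq> []" "period_lang s vs ys"
  shows "rest_lang s (enc_letters us @ [Bar] @ ys)"
proof -
  obtain zs where "rest_lang s zs" "ys = enc_letters vs @ [Semi] @ zs"
    using assms(2) unfolding period_lang_def by blast
  then show ?thesis
    using rest_lang_word[of s zs vs us] assms(1) by simp
qed

lemma phase_lang_RS:
  assumes "phase_lang (RL s False) xs"
  shows "phase_lang (RS s) xs"
proof -
  from phase_lang_RA[OF assms] obtain us vs ys where "vs \<noteq> []" "period_lang s vs ys"
    "xs = enc_letters us @ [Bar] @ ys"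
    by auto
  then show ?thesis
    using rest_lang_Bar by simp
qed

lemma rest_lang_Hash:
  "rest_lang True ys \<Longrightarrow> rest_lang False (Hash # ys)"
  "rest_lang True (Hash # enc_num B)"
proof -
  show "rest_lang False (Hash # ys)" if "rest_lang True ys"
  proof -
    obtain N B where "\<forall>w \<in> set N. snd w \<noteq> []" "ys = concat (map enc_raw_word N) @ [Hash] @ enc_num B"
      using \<open>rest_lang True ys\<close> unfolding rest_lang_def by auto
    then show ?thesis
      unfolding rest_lang_def by (intro exI[of _ "[]"] exI[of _ N] exI[of _ B]) auto
  qed
  show "rest_lang True (Hash # enc_num B)"
    unfolding rest_lang_def by (intro exI[of _ "[]"] exI[of _ B]) auto
qed

text \<open>The residual languages are closed under prepending a symbol that the automaton can read,
  which is the induction step of \<open>accepts_phase_lang\<close>. Nonemptiness of the period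
  enters at \<open>Bar\<close>, through \<open>RB\<close>.\<close>

lemma phase_lang_step:
  assumes ph: "next_phase ph y = Some ph'" and L: "phase_lang ph' ys"
  shows "phase_lang ph (y # ys)"
proof (cases ph)
  case RP
  consider "y = Tick" "ph' = RP" | "y = Dot" "ph' = RS False"
    using ph RP by (cases y) simp_all
  then show ?thesis
  proof cases
    case 1
    with L obtain p zs where "rest_lang False zs" "ys = enc_num p @ zs"
      by auto
    then have "rest_lang False zs" "y # ys = enc_num (Suc p) @ zs"
      using 1 by (simp_all add: enc_num_def)
    then show ?thesis
      unfolding RP phase_lang.simps by blast
  next
    case 2
    then have "rest_lang False ys" "y # ys = enc_num 0 @ ys"
      using L by (simp_all add: enc_num_def)
    then show ?thesis
      unfolding RP phase_lang.simps by blast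
  qed
next
  case RN
  consider "y = Tick" "ph' = RN" | "y = Dot" "ph' = RE"
    using ph RN by (cases y) simp_all
  then show ?thesis
  proof cases
    case 1
    with L obtain B where "ys = enc_num B"
      by auto
    then have "y # ys = enc_num (Suc B)"
      using 1 by (simp add: enc_num_def)
    then show ?thesis
      unfolding RN phase_lang.simps by blast
  next
    case 2
    then have "y # ys = enc_num 0"
      using L by (simp add: enc_num_def)
    then show ?thesis
      unfolding RN phase_lang.simps by blast
  qed
next
  case RE
  then show ?thesis
    using ph by simp
next
  case (RL s v)
  show ?thesis
    unfolding RL by (rule phase_lang_letter[OF _ L]) (use ph RL in simp)
next
  case (RS s)
  consider "y = Hash" | "y = Bar" | "letter_phase s False y = Some ph'"
    using ph RS by (cases y) simp_all
  then show ?thesis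
  proof cases
    case 1
    show ?thesis
    proof (cases s)
      case True
      then have "ph' = RN"
        using 1 ph RS by simp
      with L obtain B where "ys = enc_num B"
        by auto
      then show ?thesis
        using 1 RS True rest_lang_Hash(2) by simp
    next
      case False
      then have "ph' = RS True"
        using 1 ph RS by simp
      then show ?thesis
        using 1 L RS False rest_lang_Hash(1) by simp
    qed
  next
    case 2
    then have "ph' = RB s False"
      using ph RS by simp
    with L obtain vs where "vs \<noteq> []" "period_lang s vs ys"
      by auto
    then show ?thesis
      using rest_lang_Bar[of vs s ys "[]"] 2 RS by simp
  next
    case 3
    show ?thesis
      unfolding RS by (rule phase_lang_RS[OF phase_lang_letter[OF 3 L]])
  qed
next
  case (RA s v)
  consider "y = Bar" | "y = Semi" | "letter_phase s v y = Some ph'"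
    using ph RA by (cases y) simp_all
  then show ?thesis
  proof cases
    case 1
    then have v: "\<not> v" and "ph' = RB s True"
      using ph RA by (simp_all split: if_splits)
    with L obtain vs where "vs \<noteq> []" "period_lang s vs ys"
      by auto
    moreover have "y # ys = enc_letters [] @ [Bar] @ ys"
      using 1 by simp
    ultimately have "\<exists>us vs zs. vs \<noteq> [] \<and> period_lang s vs zs \<and> y # ys = enc_letters us @ [Bar] @ zs"
      by blast
    then show ?thesis
      using RA v by simp
  next
    case 2
    then have v: v and "ph' = RS s"
      using ph RA by (simp_all split: if_splits)
    then have "period_lang s [] (y # ys)"
      using L 2 by (simp add: period_lang_def)
    then have "\<exists>vs. period_lang s vs (y # ys)"
      by blast
    then show ?thesis
      using RA v by simp
  next
    case 3
    show ?thesis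
      unfolding RA by (rule phase_lang_RA[OF phase_lang_letter[OF 3 L]])
  qed
next
  case (RB s f)
  show ?thesis
    unfolding RB by (rule phase_lang_RB, rule phase_lang_letter[OF _ L]) (use ph RB in simp)
qed

lemma accepts_phase_lang: "accepts xs ph \<Longrightarrow> phase_lang ph xs"
proof (induction xs arbitrary: ph)
  case (Cons y ys)
  then obtain ph' where "next_phase ph y = Some ph'" "accepts ys ph'"
    by auto
  then show ?case
    using Cons.IH phase_lang_step by blast
qed simp

lemma accepts_sample:
  assumes "accepts xs RP"
  obtains p P N B where "\<forall>w \<in> set P \<union> set N. snd w \<noteq> []" "xs = enc_sample (\<lambda>_. enc_raw_word) p P N B"
proof -
  obtain p ys where "rest_lang False ys" "xs = enc_num p @ ys"
    using accepts_phase_lang[OF assms] by auto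
  moreover from this(1) obtain P N B where "\<forall>w \<in> set P \<union> set N. snd w \<noteq> []"
    "ys = (concat (map enc_raw_word P) @ [Hash]) @ concat (map enc_raw_word N) @ [Hash] @ enc_num B"
    unfolding rest_lang_def if_False by blast
  ultimately show ?thesis
    using that[of P N p B] by (simp add: enc_sample_def)
qed


subsection \<open>The output of the transducer\<close>

text \<open>Action counts and targets are both written with \<open>enc_num\<close>, so one list
  holds all numbers of a state: \<open>ks\<close> is empty for Kripke structures and consists of
  ones for game structures. \<open>t\<close> is the target of the back edge.\<close>

primrec lasso_from :: "nat list \<Rightarrow> nat \<Rightarrow> nat \<Rightarrow> bool list list \<Rightarrow> raw_state list" where
  "lasso_from ks t i [] = []"
| "lasso_from ks t i (l # ls) =
     (i = 0, l, ks @ [if ls = [] then t else Suc i]) # lasso_from ks t (Suc i) ls"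

fun lasso :: "nat list \<Rightarrow> raw_word \<Rightarrow> raw_state list" where
  "lasso ks (u, v) = lasso_from ks (length u) 0 (u @ v)"

lemma length_lasso_from [simp]: "length (lasso_from ks t i ls) = length ls"
  by (induction ls arbitrary: i) auto

lemma nth_lasso_from:
  "j < length ls \<Longrightarrow> lasso_from ks t i ls ! j =
     (i + j = 0, ls ! j, ks @ [if Suc j < length ls then Suc (i + j) else t])"
  by (induction ls arbitrary: i j) (auto simp: nth_Cons split: nat.splits)

text \<open>Output for letters read while a state is still open: each letter first supplies the
  successor of the state before it.\<close>

primrec chain :: "sym list \<Rightarrow> nat \<Rightarrow> bool list list \<Rightarrow> sym list" where
  "chain pre a [] = []"
| "chain pre a (l # ls) = emit_succ a @ enc_bits l @ pre @ chain pre (Suc a) ls"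

lemma chain_append: "chain pre a (us @ vs) = chain pre a us @ chain pre (a + length us) vs"
  by (induction us arbitrary: a) auto

context
  fixes ks :: "nat list" and pre :: "sym list"
  assumes pre: "pre = concat (map enc_num ks)"
begin

text \<open>The encoding is cut at state boundaries, the output of the transducer just before each
  successor; this regrouping reconciles the two.\<close>

lemma enc_lasso_from:
  "concat (map enc_raw_state (lasso_from ks t i (l # ls))) =
     enc_bit (i = 0) # enc_bits l @ pre @ chain pre (Suc i) ls @ replicate t Tick @ [Dot, Bar]"
proof (induction ls arbitrary: i l)
  case Nil
  then show ?case
    by (simp add: enc_num_def flip: pre)
next
  case (Cons m ls)
  from Cons[of "Suc i" m] show ?case
    by (simp add: enc_num_def emit_succ_def flip: pre) (simp add: enc_bit_def)
qed

section \<open>The output on letters, words and samples\<close>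

lemma translate_bits:
  "translate pre (enc_bits l @ zs) (RL s v) a c =
     enc_bits l @ pre @ translate pre zs (RA s v) (Suc a) (if v then c else Suc c)"
proof (induction l)
  case Nil
  then show ?case
    by (simp add: enc_bits_def letter_phase_def emit_letter_def next_a_def next_c_def)
next
  case (Cons b l)
  then show ?case
    using enc_bit_simps(6)[of b]
    by (simp add: enc_bits_def letter_phase_def emit_letter_def next_a_def next_c_def)
qed

text \<open>\<open>RS\<close>, \<open>RA\<close> and \<open>RB\<close> treat a letter alike except
  for the string \<open>w\<close> written before it: after the first bit they are all in phase
  \<open>RL\<close>.\<close>

lemma translate_first_letter:
  assumes "\<And>y. y \<in> {Zero, One, Dot} \<Longrightarrow> next_phase ph y = letter_phase s v y"
    and "\<And>y. y \<in> {Zero, One, Dot} \<Longrightarrow> emit_sym pre ph y a c = w @ emit_letter pre y"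
    and "incs_a ph" "incs_c ph \<longleftrightarrow> \<not> v"
  shows "translate pre (enc_bits l @ zs) ph a c =
    w @ enc_bits l @ pre @ translate pre zs (RA s v) (Suc a) (if v then c else Suc c)"
proof (cases l)
  case Nil
  then show ?thesis
    using assms by (simp add: enc_bits_def letter_phase_def emit_letter_def next_a_def next_c_def)
next
  case (Cons b l')
  have b: "enc_bit b \<in> {Zero, One, Dot}"
    by (simp add: enc_bit_def)
  have "letter_phase s v (enc_bit b) = Some (RL s v)"
    by (simp add: letter_phase_def)
  then have "translate pre (enc_bits l @ zs) ph a c =
      (w @ [enc_bit b]) @ translate pre (enc_bits l' @ zs) (RL s v) a c"
    using Cons assms(1,2)[OF b] by (simp add: enc_bits_def emit_letter_def next_a_def next_c_def)
  then show ?thesis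
    unfolding translate_bits Cons by (simp add: enc_bits_def)
qed

lemma translate_RS_letter:
  "translate pre (enc_bits l @ zs) (RS s) a c =
     One # enc_bits l @ pre @ translate pre zs (RA s False) (Suc a) (Suc c)"
  by (subst translate_first_letter[of "RS s" s False a c "[One]"]) auto

lemma translate_RA_letter:
  "translate pre (enc_bits l @ zs) (RA s v) a c =
     emit_succ a @ enc_bits l @ pre @ translate pre zs (RA s v) (Suc a) (if v then c else Suc c)"
  by (rule translate_first_letter) auto

lemma translate_RB_letter:
  "translate pre (enc_bits l @ zs) (RB s f) a c =
     (if f then emit_succ a else [One]) @ enc_bits l @ pre @ translate pre zs (RA s True) (Suc a) c"
  by (subst translate_first_letter[of "RB s f" s True a c "if f then emit_succ a else [One]"]) auto

lemma translate_letters: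
  "translate pre (enc_letters ls @ zs) (RA s v) a c =
     chain pre a ls @ translate pre zs (RA s v) (a + length ls) (if v then c else c + length ls)"
  by (induction ls arbitrary: a c) (auto simp: translate_RA_letter)

lemma translate_Semi:
  "translate pre (Semi # zs) (RA s True) a c = replicate c Tick @ [Dot, Bar, Semi] @ translate pre zs (RS s) 0 0"
  by (simp add: next_a_def next_c_def)

lemma translate_word:
  assumes "v \<noteq> []"
  shows "translate pre (enc_raw_word (u, v) @ zs) (RS s) 0 0 =
    enc_raw_model (lasso ks (u, v)) @ translate pre zs (RS s) 0 0"
proof -
  obtain m ms where v: "v = m # ms"
    using assms by (cases v) auto
  show ?thesis
  proof (cases u)
    \<comment> \<open>With an empty prefix, state 0 comes from the period: it is opened in phase
      \<open>RB s False\<close>, and \<open>c\<close> is still 0, so the back edge leads to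
      it.\<close>
    case Nil
    have "translate pre (enc_raw_word (u, v) @ zs) (RS s) 0 0 =
      translate pre (enc_bits m @ enc_letters ms @ Semi # zs) (RB s False) 0 0"
      using Nil v by (simp add: next_a_def next_c_def)
    also have "\<dots> = One # enc_bits m @ pre @ chain pre 1 ms @ [Dot, Bar, Semi] @ translate pre zs (RS s) 0 0"
      unfolding translate_RB_letter translate_letters translate_Semi by simp
    also have "\<dots> = enc_raw_model (lasso ks (u, v)) @ translate pre zs (RS s) 0 0"
      using Nil v enc_lasso_from[of 0 0 m ms] by (simp add: enc_raw_model_def enc_bit_def)
    finally show ?thesis .
  next
    case (Cons l us)
    \<comment> \<open>Both counters have this value at the separator; \<open>a\<close> goes on,
      while \<open>c\<close> is kept as the target of the back edge.\<close>
    let ?t = "Suc (length us)"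
    have "translate pre (enc_raw_word (u, v) @ zs) (RS s) 0 0 =
      translate pre (enc_bits l @ enc_letters us @ Bar # enc_letters v @ Semi # zs) (RS s) 0 0"
      using Cons by simp
    also have "\<dots> = One # enc_bits l @ pre @ chain pre 1 us @
       translate pre (Bar # enc_letters v @ Semi # zs) (RA s False) ?t ?t"
      unfolding translate_RS_letter translate_letters by simp
    also have "translate pre (Bar # enc_letters v @ Semi # zs) (RA s False) ?t ?t =
      translate pre (enc_bits m @ enc_letters ms @ Semi # zs) (RB s True) ?t ?t"
      using v by (simp add: next_a_def next_c_def)
    also have "\<dots> = chain pre ?t v @ replicate ?t Tick @ [Dot, Bar, Semi] @ translate pre zs (RS s) 0 0"
      unfolding translate_RB_letter translate_letters translate_Semi using v by simp
    also have "One # enc_bits l @ pre @ chain pre 1 us @ \<dots> =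
      enc_raw_model (lasso ks (u, v)) @ translate pre zs (RS s) 0 0"
      using Cons enc_lasso_from[of ?t 0 l "us @ v"]
      by (simp add: enc_raw_model_def enc_bit_def chain_append)
    finally show ?thesis .
  qed
qed

lemma translate_words:
  assumes "\<forall>w \<in> set ws. snd w \<noteq> []"
  shows "translate pre (concat (map enc_raw_word ws) @ zs) (RS s) 0 0 =
    concat (map enc_raw_model (map (lasso ks) ws)) @ translate pre zs (RS s) 0 0"
  using assms
proof (induction ws)
  case (Cons w ws)
  obtain u v where w: "w = (u, v)"
    by (cases w)
  have "v \<noteq> []"
    using Cons.prems unfolding w by simp
  have "translate pre (concat (map enc_raw_word (w # ws)) @ zs) (RS s) 0 0 =
      translate pre (enc_raw_word (u, v) @ concat (map enc_raw_word ws) @ zs) (RS s) 0 0"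
    by (simp only: w concat.simps list.map append_assoc)
  also have "\<dots> = enc_raw_model (lasso ks (u, v)) @ translate pre (concat (map enc_raw_word ws) @ zs) (RS s) 0 0"
    by (rule translate_word[OF \<open>v \<noteq> []\<close>])
  also have "translate pre (concat (map enc_raw_word ws) @ zs) (RS s) 0 0 =
      concat (map enc_raw_model (map (lasso ks) ws)) @ translate pre zs (RS s) 0 0"
    by (rule Cons.IH) (use Cons.prems in simp)
  finally show ?case
    by (simp only: w concat.simps list.map append_assoc)
qed simp

lemma translate_RP: "translate pre (enc_num p @ zs) RP 0 0 = enc_num p @ translate pre zs (RS False) 0 0"
  by (induction p) (auto simp: enc_num_def next_a_def next_c_def)

lemma translate_RN: "translate pre (enc_num B) RN 0 0 = enc_num B"
  by (induction B) (auto simp: enc_num_def next_a_def next_c_def)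

lemma translate_Hash:
  "translate pre (Hash # zs) (RS s) 0 0 = Hash # translate pre zs (if s then RN else RS True) 0 0"
  by (simp add: next_a_def next_c_def)

lemma translate_sample:
  assumes "\<forall>w \<in> set P \<union> set N. snd w \<noteq> []"
  shows "translate pre (enc_sample (\<lambda>_. enc_raw_word) p P N B) RP 0 0 =
    enc_sample (\<lambda>_. enc_raw_model) p (map (lasso ks) P) (map (lasso ks) N) B"
proof -
  have P: "\<forall>w \<in> set P. snd w \<noteq> []" and N: "\<forall>w \<in> set N. snd w \<noteq> []"
    using assms by auto
  show ?thesis
    unfolding enc_sample_def append_Cons append_Nil
    by (simp only: translate_RP translate_words[OF P] translate_words[OF N] translate_Hash translate_RN
        if_True if_False)
qed

end

text \<open>An encoded sample ends in \<open>Dot\<close> and a failed run in \<open>Zero\<close>, so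
  the input was accepted and comes from raw words. Their translation is computed by
  \<open>translate_sample\<close>, and unique parsing matches it with the given sample part by
  part.\<close>

lemma translate_eq_sampleD:
  assumes "translate (concat (map enc_num ks)) x RP 0 0 = enc_sample (\<lambda>_. enc_raw_model) p P' N' B"
  obtains P N where "\<forall>w \<in> set P \<union> set N. snd w \<noteq> []" "x = enc_sample (\<lambda>_. enc_raw_word) p P N B"
    "P' = map (lasso ks) P" "N' = map (lasso ks) N"
proof -
  have "accepts x RP"
  proof (rule ccontr)
    assume "\<not> accepts x RP"
    then obtain w where "translate (concat (map enc_num ks)) x RP 0 0 = w @ [Zero]"
      using translate_rejected by blast
    moreover obtain w' where "enc_sample (\<lambda>_. enc_raw_model) p P' N' B = w' @ [Dot]"
      using enc_sample_last by blast
    ultimately show False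
      unfolding assms by simp
  qed
  then obtain p' P N B' where *: "\<forall>w \<in> set P \<union> set N. snd w \<noteq> []"
    "x = enc_sample (\<lambda>_. enc_raw_word) p' P N B'"
    by (rule accepts_sample)
  have "enc_sample (\<lambda>_. enc_raw_model) p' (map (lasso ks) P) (map (lasso ks) N) B' =
      enc_sample (\<lambda>_. enc_raw_model) p P' N' B"
    using translate_sample[OF refl *(1), of ks p' B'] unfolding *(2)[symmetric] assms by (rule sym)
  note eq = enc_raw_sample_inject[OF this]
  show ?thesis
  proof (rule that[OF *(1)])
    show "x = enc_sample (\<lambda>_. enc_raw_word) p P N B"
      using eq *(2) by blast
  qed (use eq in blast)+
qed


section \<open>Alternating-time formulas on lassos\<close>

primrec to_ltl :: "atl \<Rightarrow> ltl" and path_to_ltl :: "atl_path \<Rightarrow> ltl" where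
  "to_ltl (AProp p) = LProp p"
| "to_ltl (ANeg \<phi>) = LUn Neg (to_ltl \<phi>)"
| "to_ltl (ALBin op \<phi> \<psi>) = LLBin op (to_ltl \<phi>) (to_ltl \<psi>)"
| "to_ltl (Coal A \<psi>) = path_to_ltl \<psi>"
| "path_to_ltl (PUn op \<phi>) = LUn op (to_ltl \<phi>)"
| "path_to_ltl (PTBin op \<phi> \<psi>) = LTBin op (to_ltl \<phi>) (to_ltl \<psi>)"

text \<open>The empty coalition is available for every number of agents. \<open>Neg\<close> must
  become \<open>ANeg\<close>, as the path formulas of a fragment exclude it.\<close>

primrec of_ltl :: "ltl \<Rightarrow> atl" where
  "of_ltl (LProp p) = AProp p"
| "of_ltl (LUn op \<phi>) = (if op = Neg then ANeg (of_ltl \<phi>) else Coal {} (PUn op (of_ltl \<phi>)))"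
| "of_ltl (LTBin op \<phi> \<psi>) = Coal {} (PTBin op (of_ltl \<phi>) (of_ltl \<psi>))"
| "of_ltl (LLBin op \<phi> \<psi>) = ALBin op (of_ltl \<phi>) (of_ltl \<psi>)"

section \<open>Fragments and sizes under the translation of formulas\<close>

lemma to_ltl_of_ltl [simp]: "to_ltl (of_ltl \<phi>) = \<phi>"
  by (induction \<phi>) auto

lemma atl_frag_of_ltl: "ltl_frag AP Ut Bt Bl \<phi> \<Longrightarrow> atl_frag k AP Ut Bt Bl (of_ltl \<phi>)"
  by (induction \<phi>) auto

lemma ltl_frag_to_ltl:
  "atl_frag k AP Ut Bt Bl \<phi> \<Longrightarrow> ltl_frag AP Ut Bt Bl (to_ltl \<phi>)"
  "atl_path_frag k AP Ut Bt Bl \<psi> \<Longrightarrow> ltl_frag AP Ut Bt Bl (path_to_ltl \<psi>)"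
  by (induction \<phi> and \<psi>) auto

lemma finite_atl_sub: "finite (atl_sub \<phi>)" "finite (atl_path_sub \<psi>)"
  by (induction \<phi> and \<psi>) auto

lemma atl_sub_of_ltl: "atl_sub (of_ltl \<phi>) = of_ltl ` ltl_sub \<phi>"
  by (induction \<phi>) auto

lemma ltl_sub_to_ltl:
  "ltl_sub (to_ltl \<phi>) = to_ltl ` atl_sub \<phi>"
  "ltl_sub (path_to_ltl \<psi>) = insert (path_to_ltl \<psi>) (to_ltl ` atl_path_sub \<psi>)"
  by (induction \<phi> and \<psi>) auto

lemma atl_is_bin_of_ltl: "atl_is_bin (of_ltl \<phi>) \<longleftrightarrow> ltl_is_bin \<phi>"
  by (cases \<phi>) auto

lemma ltl_is_bin_to_ltl: "ltl_is_bin (to_ltl \<phi>) \<longleftrightarrow> atl_is_bin \<phi>"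
  by (induction \<phi> rule: atl_is_bin.induct) auto

lemma inj_of_ltl: "inj of_ltl"
  by (rule inj_on_inverseI[of _ to_ltl]) simp

lemma atl_size_of_ltl: "atl_size (of_ltl \<phi>) = ltl_size \<phi>"
  unfolding atl_size_def ltl_size_def atl_sub_of_ltl
  by (rule card_image) (rule inj_on_subset[OF inj_of_ltl subset_UNIV])

lemma atl_bin_size_of_ltl: "atl_bin_size (of_ltl \<phi>) = ltl_bin_size \<phi>"
proof -
  have "{\<psi> \<in> atl_sub (of_ltl \<phi>). atl_is_bin \<psi>} = of_ltl ` {\<psi> \<in> ltl_sub \<phi>. ltl_is_bin \<psi>}"
    by (auto simp: atl_sub_of_ltl atl_is_bin_of_ltl)
  then show ?thesis
    unfolding atl_bin_size_def ltl_bin_size_def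
    by (simp add: card_image inj_on_subset[OF inj_of_ltl subset_UNIV])
qed

text \<open>Only an inequality: subformulas that differ merely in their coalitions become
  equal.\<close>

lemma ltl_size_to_ltl: "ltl_size (to_ltl \<phi>) \<le> atl_size \<phi>"
  unfolding atl_size_def ltl_size_def ltl_sub_to_ltl by (rule card_image_le[OF finite_atl_sub(1)])

lemma ltl_bin_size_to_ltl: "ltl_bin_size (to_ltl \<phi>) \<le> atl_bin_size \<phi>"
proof -
  have "{\<psi> \<in> ltl_sub (to_ltl \<phi>). ltl_is_bin \<psi>} = to_ltl ` {\<psi> \<in> atl_sub \<phi>. atl_is_bin \<psi>}"
    by (auto simp: ltl_sub_to_ltl ltl_is_bin_to_ltl)
  then show ?thesis
    unfolding atl_bin_size_def ltl_bin_size_def by (simp add: card_image_le finite_atl_sub)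
qed

section \<open>Structures with a single action per agent\<close>

definition deterministic :: "'q cgs \<Rightarrow> ('q \<Rightarrow> 'q) \<Rightarrow> bool" where
  "deterministic C f \<longleftrightarrow> (\<forall>q \<in> states C. f q \<in> states C \<and> (\<forall>a \<in> {1..agents C}. num_acts C q a = 1) \<and>
     trans_fun C q (replicate (agents C) 1) = f q)"

lemma joint_acts_single:
  assumes "\<forall>a \<in> {1..agents C}. num_acts C q a = 1"
  shows "joint_acts C q = {replicate (agents C) 1}"
proof -
  have "\<alpha> = replicate (agents C) 1" if "\<alpha> \<in> joint_acts C q" for \<alpha>
  proof (rule nth_equalityI)
    show len: "length \<alpha> = length (replicate (agents C) (1 :: nat))"
      using that by (simp add: joint_acts_def)
    show "\<alpha> ! i = replicate (agents C) 1 ! i" if i: "i < length \<alpha>" for i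
    proof -
      have "Suc i \<in> {1..agents C}"
        using i len by simp
      then have "\<alpha> ! (Suc i - 1) \<in> {1..num_acts C q (Suc i)}" "num_acts C q (Suc i) = 1"
        using \<open>\<alpha> \<in> _\<close> assms unfolding joint_acts_def by blast+
      then show ?thesis
        using i len by simp
    qed
  qed
  moreover have "replicate (agents C) 1 ! (a - 1) = (1 :: nat)" if "a \<in> {1..agents C}" for a
    using that by (intro nth_replicate) auto
  then have "replicate (agents C) 1 \<in> joint_acts C q"
    using assms by (simp add: joint_acts_def)
  ultimately show ?thesis
    by blast
qed

text \<open>On histories of states a strategy can only choose action 1, so imposing it does not
  remove the one path that there is.\<close>

lemma outcomes_deterministic:
  assumes det: "deterministic C f" and q: "q \<in> states C" and A: "A \<subseteq> {1..agents C}"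
    and s: "\<forall>a \<in> A. is_strategy C a (s a)"
  shows "outcomes C A s q = {\<lambda>i. (f ^^ i) q}"
proof -
  have st: "(f ^^ i) q \<in> states C" for i
    using det q by (induction i) (simp_all add: deterministic_def)
  have acts: "\<forall>a \<in> {1..agents C}. num_acts C p a = 1"
    and step: "trans_fun C p (replicate (agents C) 1) = f p" if "p \<in> states C" for p
    using det that by (simp_all add: deterministic_def)
  have joint: "joint_acts C p = {replicate (agents C) 1}" if "p \<in> states C" for p
    by (rule joint_acts_single[OF acts[OF that]])
  have "\<rho> = (\<lambda>i. (f ^^ i) q)" if \<rho>: "\<rho> \<in> outcomes C A s q" for \<rho>
  proof
    fix i
    show "\<rho> i = (f ^^ i) q"
    proof (induction i)
      case 0
      then show ?case
        using \<rho> by (simp add: outcomes_def)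
    next
      case (Suc i)
      obtain \<alpha> where "\<alpha> \<in> joint_acts C (\<rho> i)" "\<rho> (Suc i) = trans_fun C (\<rho> i) \<alpha>"
        using \<rho> unfolding outcomes_def by blast
      then show ?case
        using joint[OF st[of i]] step[OF st[of i]] unfolding Suc.IH by simp
    qed
  qed
  moreover have "(\<lambda>i. (f ^^ i) q) \<in> outcomes C A s q"
  proof -
    have *: "\<forall>a \<in> A. replicate (agents C) 1 ! (a - 1) = s a (map (\<lambda>i. (f ^^ i) q) [0..<Suc i])" for i
    proof
      fix a assume a: "a \<in> A"
      let ?h = "map (\<lambda>i. (f ^^ i) q) [0..<Suc i]"
      have h: "?h \<noteq> [] \<and> set ?h \<subseteq> states C" "last ?h = (f ^^ i) q"
        using st by auto
      have "is_strategy C a (s a)"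
        using s a by blast
      then have "s a ?h \<in> {1..num_acts C (last ?h) a}"
        unfolding is_strategy_def using h(1) by blast
      then have "s a ?h \<in> {1..num_acts C ((f ^^ i) q) a}"
        unfolding h(2) .
      moreover have "num_acts C ((f ^^ i) q) a = 1"
        using acts[OF st] a A by blast
      moreover have "a - 1 < agents C"
        using subsetD[OF A a] by auto
      ultimately show "replicate (agents C) 1 ! (a - 1) = s a ?h"
        by simp
    qed
    show ?thesis
      unfolding outcomes_def mem_Collect_eq
    proof (intro conjI allI bexI)
      show "replicate (agents C) 1 \<in> joint_acts C ((f ^^ i) q)" for i
        unfolding joint[OF st] by simp
      show "(f ^^ Suc i) q = trans_fun C ((f ^^ i) q) (replicate (agents C) 1)" for i
        using step[OF st] by simp
    qed (use * in simp_all)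
  qed
  ultimately show ?thesis
    by blast
qed

lemma funpow_apply_add: "(f ^^ j) ((f ^^ i) q) = (f ^^ (i + j)) q"
  by (simp only: add.commute[of i j] funpow_add comp_apply)

text \<open>A suffix of an orbit is the orbit of a later state, which turns the LTL suffixes at
  temporal operators into instances of the induction hypothesis. Membership in the fragment confines
  coalitions to actual agents, for which alone the number of actions is known.\<close>

lemma atl_sat_deterministic:
  assumes det: "deterministic C f"
  shows "atl_frag (agents C) AP Ut Bt Bl \<phi> \<Longrightarrow> q \<in> states C \<Longrightarrow>
      atl_sat C \<phi> q \<longleftrightarrow> ltl_sat (\<lambda>i. label C ((f ^^ i) q)) (to_ltl \<phi>)"
    and "atl_path_frag (agents C) AP Ut Bt Bl \<psi> \<Longrightarrow> q \<in> states C \<Longrightarrow>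
      atl_path_sat C \<psi> (\<lambda>i. (f ^^ i) q) \<longleftrightarrow> ltl_sat (\<lambda>i. label C ((f ^^ i) q)) (path_to_ltl \<psi>)"
proof (induction \<phi> and \<psi> arbitrary: q and q)
  case (Coal A \<psi>)
  then have A: "A \<subseteq> {1..agents C}"
    by simp
  \<comment> \<open>A quantifier also asserts that strategies exist; the constant action 1 is
    one.\<close>
  have strat: "is_strategy C a (\<lambda>_. 1)" if "a \<in> A" for a
    unfolding is_strategy_def
  proof (intro allI impI)
    fix h assume "h \<noteq> [] \<and> set h \<subseteq> states C"
    then have "last h \<in> states C"
      using last_in_set by blast
    then show "1 \<in> {1..num_acts C (last h) a}"
      using det that A unfolding deterministic_def by fastforce
  qed
  have "atl_sat C (Coal A \<psi>) q \<longleftrightarrow> atl_path_sat C \<psi> (\<lambda>i. (f ^^ i) q)"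
  proof
    assume "atl_sat C (Coal A \<psi>) q"
    then obtain s where "\<forall>a \<in> A. is_strategy C a (s a)" "\<forall>\<rho> \<in> outcomes C A s q. atl_path_sat C \<psi> \<rho>"
      by auto
    then show "atl_path_sat C \<psi> (\<lambda>i. (f ^^ i) q)"
      using outcomes_deterministic[OF det Coal.prems(2) A] by blast
  next
    assume "atl_path_sat C \<psi> (\<lambda>i. (f ^^ i) q)"
    then have "\<forall>\<rho> \<in> outcomes C A (\<lambda>_ _. 1) q. atl_path_sat C \<psi> \<rho>"
      using outcomes_deterministic[OF det Coal.prems(2) A, of "\<lambda>_ _. 1"] strat by simp
    then show "atl_sat C (Coal A \<psi>) q"
      unfolding atl_sat.simps by (intro exI[of _ "\<lambda>_ _. 1"]) (use strat in blast)
  qed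
  then show ?case
    using Coal by simp
next
  case (PUn op \<phi>)
  have st: "(f ^^ i) q \<in> states C" for i
    using det PUn.prems(2) by (induction i) (simp_all add: deterministic_def)
  have "atl_sat C \<phi> ((f ^^ i) q) \<longleftrightarrow> ltl_sat (\<lambda>j. label C ((f ^^ (i + j)) q)) (to_ltl \<phi>)" for i
    using PUn.IH[OF _ st[of i]] PUn.prems(1) by (simp add: funpow_apply_add)
  then show ?case
    by simp
next
  case (PTBin op \<phi> \<chi>)
  have st: "(f ^^ i) q \<in> states C" for i
    using det PTBin.prems(2) by (induction i) (simp_all add: deterministic_def)
  have "atl_sat C \<phi> ((f ^^ i) q) \<longleftrightarrow> ltl_sat (\<lambda>j. label C ((f ^^ (i + j)) q)) (to_ltl \<phi>)"
    "atl_sat C \<chi> ((f ^^ i) q) \<longleftrightarrow> ltl_sat (\<lambda>j. label C ((f ^^ (i + j)) q)) (to_ltl \<chi>)" for i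
    using PTBin.IH(1)[OF _ st[of i]] PTBin.IH(2)[OF _ st[of i]] PTBin.prems(1)
    by (simp_all add: funpow_apply_add)
  then show ?case
    by simp
qed simp_all


subsection \<open>Lassos\<close>

definition lasso_next :: "up_word \<Rightarrow> nat \<Rightarrow> nat" where
  "lasso_next w i = (if Suc i < length (fst w @ snd w) then Suc i else length (fst w))"

definition lasso_pos :: "up_word \<Rightarrow> nat \<Rightarrow> nat" where
  "lasso_pos w i =
     (if i < length (fst w) then i else length (fst w) + (i - length (fst w)) mod length (snd w))"

text \<open>The wrap-around in \<open>mod_Suc\<close> is exactly the back edge of the lasso.\<close>

lemma funpow_lasso_next:
  assumes "snd w \<noteq> []"
  shows "(lasso_next w ^^ i) 0 = lasso_pos w i"
proof (induction i)
  case 0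
  then show ?case
    by (simp add: lasso_pos_def)
next
  case (Suc i)
  let ?u = "length (fst w)" and ?v = "length (snd w)"
  have "?v > 0"
    using assms by simp
  show ?case
  proof (cases "i < ?u")
    case True
    then show ?thesis
      using Suc \<open>?v > 0\<close> by (auto simp: lasso_pos_def lasso_next_def)
  next
    case False
    then have "lasso_pos w (Suc i) = ?u + Suc (i - ?u) mod ?v"
      by (simp add: lasso_pos_def Suc_diff_le)
    moreover have "lasso_pos w i = ?u + (i - ?u) mod ?v"
      using False by (simp add: lasso_pos_def)
    moreover have "(i - ?u) mod ?v < ?v"
      using \<open>?v > 0\<close> by simp
    ultimately show ?thesis
      using Suc by (auto simp: lasso_next_def mod_Suc)
  qed
qed

lemma lasso_next_less: "snd w \<noteq> [] \<Longrightarrow> lasso_next w i < length (fst w @ snd w)"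
  by (auto simp: lasso_next_def)

lemma up_word_at_lasso_pos: "up_word_at w i = (fst w @ snd w) ! lasso_pos w i"
  by (cases w) (simp add: lasso_pos_def nth_append)

text \<open>Labels and transitions are fixed on states only, as an encoding says nothing about them
  elsewhere.\<close>

definition is_lasso :: "nat cgs \<Rightarrow> up_word \<Rightarrow> bool" where
  "is_lasso C w \<longleftrightarrow> states C = {..<length (fst w @ snd w)} \<and> initial C = {0} \<and>
     (\<forall>q < length (fst w @ snd w). label C q = (fst w @ snd w) ! q) \<and> deterministic C (lasso_next w)"

lemma cgs_models_lasso:
  assumes w: "snd w \<noteq> []" and C: "is_lasso C w" and \<phi>: "atl_frag (agents C) AP Ut Bt Bl \<phi>"
  shows "cgs_models C \<phi> \<longleftrightarrow> ltl_sat (up_word_at w) (to_ltl \<phi>)"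
proof -
  have det: "deterministic C (lasso_next w)" and states: "states C = {..<length (fst w @ snd w)}"
    and init: "initial C = {0}"
    using C by (simp_all add: is_lasso_def)
  have "(lasso_next w ^^ i) 0 < length (fst w @ snd w)" for i
    using w lasso_next_less[OF w] by (cases i) simp_all
  then have "label C ((lasso_next w ^^ i) 0) = up_word_at w i" for i
    using C unfolding is_lasso_def up_word_at_lasso_pos funpow_lasso_next[OF w] by blast
  moreover have "0 \<in> states C"
    using w states by simp
  ultimately show ?thesis
    using atl_sat_deterministic(1)[OF det \<phi>, of 0] by (simp add: cgs_models_def init)
qed

section \<open>Raw encodings of words and structures\<close>

definition bits :: "nat \<Rightarrow> nat set \<Rightarrow> bool list" where
  "bits p l = map (\<lambda>i. i \<in> l) [0..<p]"

definition raw_word :: "nat \<Rightarrow> up_word \<Rightarrow> raw_word" where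
  "raw_word p w = (map (bits p) (fst w), map (bits p) (snd w))"

definition raw_kripke :: "nat \<Rightarrow> nat kripke \<Rightarrow> raw_state list" where
  "raw_kripke p K = map (\<lambda>q. (q \<in> kinitial K, bits p (klabel K q), sorted_list_of_set (succs K q)))
     [0..<card (kstates K)]"

definition raw_cgs :: "nat \<Rightarrow> nat cgs \<Rightarrow> raw_state list" where
  "raw_cgs p C = map (\<lambda>q. (q \<in> initial C, bits p (label C q),
       map (num_acts C q) [1..<Suc (agents C)] @
       map (trans_fun C q)
         (product_lists (map (\<lambda>a. [1..<Suc (num_acts C q a)]) [1..<Suc (agents C)]))))
     [0..<card (states C)]"

lemma length_bits [simp]: "length (bits p l) = p"
  by (simp add: bits_def)

lemma bits_inject: "bits p l = bits p l' \<Longrightarrow> l \<subseteq> {..<p} \<Longrightarrow> l' \<subseteq> {..<p} \<Longrightarrow> l = l'"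
  by (auto simp: bits_def)

lemma enc_letter_bits: "enc_letter p l = enc_bits (bits p l)"
  by (simp add: enc_letter_def enc_bits_def bits_def)

lemma enc_up_word_raw: "enc_up_word p w = enc_raw_word (raw_word p w)"
proof -
  have "enc_letter p = (\<lambda>l. enc_bits (bits p l))"
    by (rule ext) (rule enc_letter_bits)
  then show ?thesis
    by (simp add: enc_up_word_def raw_word_def comp_def)
qed

lemma enc_kripke_raw: "enc_kripke p K = enc_raw_model (raw_kripke p K)"
  by (simp add: enc_kripke_def raw_kripke_def enc_raw_model_def enc_letter_bits comp_def)

lemma enc_cgs_raw: "enc_cgs p C = enc_raw_model (raw_cgs p C)"
  by (simp add: enc_cgs_def raw_cgs_def enc_raw_model_def enc_letter_bits comp_def del: upt_Suc)

lemma lasso_raw_word: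
  "lasso ks (raw_word p w) = map (\<lambda>q. (q = 0, bits p ((fst w @ snd w) ! q), ks @ [lasso_next w q]))
     [0..<length (fst w @ snd w)]"
  by (rule nth_equalityI)
    (auto simp: raw_word_def nth_lasso_from lasso_next_def simp flip: map_append)

lemma up_word_letter:
  assumes "is_up_word AP w" "q < length (fst w @ snd w)"
  shows "(fst w @ snd w) ! q \<subseteq> AP"
proof -
  have "(fst w @ snd w) ! q \<in> set (fst w @ snd w)"
    using assms(2) by (rule nth_mem)
  then show ?thesis
    using assms(1) by (simp add: is_up_word_def)
qed

text \<open>A yes-instance provides some structure with the encoding of a lasso, and its components
  are recovered here. Initial states and labels are visible only through bits, so bounds on these
  sets are what makes the bits determine them.\<close>

lemma raw_lasso_eqD:
  assumes eq: "map (\<lambda>q. (q \<in> I, bits p (L q), R q)) [0..<m] = lasso ks (raw_word p w)"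
    and I: "I \<subseteq> {..<m}" and L: "\<forall>q < m. L q \<subseteq> {..<p}" and w: "is_up_word {..<p} w"
  shows "m = length (fst w @ snd w)" "I = {0}"
    "\<And>q. q < m \<Longrightarrow> L q = (fst w @ snd w) ! q" "\<And>q. q < m \<Longrightarrow> R q = ks @ [lasso_next w q]"
proof -
  show m: "m = length (fst w @ snd w)"
    using arg_cong[OF eq, of length] by (simp add: lasso_raw_word)
  have nth: "q \<in> I \<longleftrightarrow> q = 0" "bits p (L q) = bits p ((fst w @ snd w) ! q)" "R q = ks @ [lasso_next w q]"
    if "q < m" for q
    using arg_cong[OF eq, of "\<lambda>xs. xs ! q"] that by (simp_all add: lasso_raw_word m del: length_append)
  have "m > 0"
    using w m by (simp add: is_up_word_def)
  then show "I = {0}"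
    using nth(1) I by blast
  show "L q = (fst w @ snd w) ! q" if "q < m" for q
    using bits_inject[OF nth(2)[OF that]] L up_word_letter[OF w] that m by blast
  show "R q = ks @ [lasso_next w q]" if "q < m" for q
    using nth(3)[OF that] .
qed

section \<open>Structures whose encoding is a lasso\<close>

lemma kripke_is_lasso:
  assumes K: "is_kripke K" "kprops K = {..<p}" "kstates K = {..<m}" and w: "is_up_word {..<p} w"
    and eq: "raw_kripke p K = lasso [] (raw_word p w)"
  shows "is_lasso (cgs_of_kripke K) w"
proof -
  have I: "kinitial K \<subseteq> {..<m}" and L: "\<forall>q < m. klabel K q \<subseteq> {..<p}"
    using K by (auto simp: is_kripke_def)
  have "card (kstates K) = m"
    using K by simp
  note * = raw_lasso_eqD[OF eq[unfolded raw_kripke_def this] I L w]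
  have w': "snd w \<noteq> []"
    using w by (simp add: is_up_word_def)
  have sorted: "sorted_list_of_set (succs K q) = [lasso_next w q]" if "q < m" for q
    using *(4)[OF that] by simp
  moreover have "card (succs K q) = 1" if "q < m" for q
    unfolding length_sorted_list_of_set[symmetric] sorted[OF that] by simp
  ultimately have "deterministic (cgs_of_kripke K) (lasso_next w)"
    using lasso_next_less[OF w'] by (simp add: deterministic_def cgs_of_kripke_def K(3) *(1) del: length_append)
  then show ?thesis
    using *(1,2,3) K(3) by (simp add: is_lasso_def cgs_of_kripke_def)
qed

lemma product_lists_single: "product_lists (map (\<lambda>_. [c]) xs) = [replicate (length xs) c]"
  by (induction xs) auto

lemma cgs_is_lasso:
  assumes C: "is_cgs C" "agents C = k" "props C = {..<p}" "states C = {..<m}" and w: "is_up_word {..<p} w"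
    and eq: "raw_cgs p C = lasso (replicate k 1) (raw_word p w)"
  shows "is_lasso C w"
proof -
  have I: "initial C \<subseteq> {..<m}" and L: "\<forall>q < m. label C q \<subseteq> {..<p}"
    using C by (auto simp: is_cgs_def)
  have "card (states C) = m"
    using C by simp
  note * = raw_lasso_eqD[OF eq[unfolded raw_cgs_def this] I L w]
  have w': "snd w \<noteq> []"
    using w by (simp add: is_up_word_def)
  have acts: "\<forall>a \<in> {1..k}. num_acts C q a = 1" and trans: "trans_fun C q (replicate k 1) = lasso_next w q"
    if "q < m" for q
  proof -
    \<comment> \<open>The action counts and \<open>replicate k 1\<close> both have length
      \<open>k\<close>, so the equation of lists splits at the append.\<close>
    have e: "map (num_acts C q) [1..<Suc k] = replicate k 1"
      "map (trans_fun C q) (product_lists (map (\<lambda>a. [1..<Suc (num_acts C q a)]) [1..<Suc k])) = [lasso_next w q]"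
      using *(4)[OF that] C(2) by (simp_all del: upt_Suc)
    show acts: "\<forall>a \<in> {1..k}. num_acts C q a = 1"
    proof
      fix a assume "a \<in> {1..k}"
      then have "num_acts C q a \<in> set (map (num_acts C q) [1..<Suc k])"
        by (simp del: upt_Suc)
      then show "num_acts C q a = 1"
        unfolding e by simp
    qed
    \<comment> \<open>With all counts 1 there is a single joint action, and the transition table has
      a single entry.\<close>
    have l: "map (\<lambda>a. [1..<Suc (num_acts C q a)]) [1..<Suc k] = map (\<lambda>_. [1]) [1..<Suc k]"
      using acts by (intro map_cong) auto
    show "trans_fun C q (replicate k 1) = lasso_next w q"
      using e(2) unfolding l product_lists_single length_upt by simp
  qed
  have "deterministic C (lasso_next w)"
    using acts trans lasso_next_less[OF w'] C(2,4) *(1) unfolding deterministic_def by simp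
  then show ?thesis
    using *(1,2,3) C(4) by (simp add: is_lasso_def)
qed

lemma ex_lasso_kripke:
  assumes w: "is_up_word {..<p} w"
  shows "\<exists>K. (is_kripke K \<and> kprops K = {..<p} \<and> (\<exists>m. kstates K = {..<m})) \<and>
    raw_kripke p K = lasso [] (raw_word p w)"
proof -
  define K where "K = \<lparr>kstates = {..<length (fst w @ snd w)}, kinitial = {0}, kprops = {..<p},
    klabel = (\<lambda>q. (fst w @ snd w) ! q), succs = (\<lambda>q. {lasso_next w q})\<rparr>"
  have w': "snd w \<noteq> []"
    using w by (simp add: is_up_word_def)
  have "is_kripke K"
    using w' up_word_letter[OF w] lasso_next_less[OF w'] by (simp add: is_kripke_def K_def del: length_append)
  moreover have "raw_kripke p K = lasso [] (raw_word p w)"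
    by (simp add: raw_kripke_def K_def lasso_raw_word)
  ultimately show ?thesis
    by (auto simp: K_def)
qed

lemma ex_lasso_cgs:
  assumes w: "is_up_word {..<p} w" and k: "k \<ge> 1"
  shows "\<exists>C. (is_cgs C \<and> agents C = k \<and> props C = {..<p} \<and> (\<exists>m. states C = {..<m})) \<and>
    raw_cgs p C = lasso (replicate k 1) (raw_word p w)"
proof -
  define C where "C = \<lparr>states = {..<length (fst w @ snd w)}, initial = {0}, agents = k, props = {..<p},
    label = (\<lambda>q. (fst w @ snd w) ! q), num_acts = (\<lambda>_ _. 1), trans_fun = (\<lambda>q _. lasso_next w q)\<rparr>"
  have w': "snd w \<noteq> []"
    using w by (simp add: is_up_word_def)
  have "is_cgs C"
    using w' k up_word_letter[OF w] lasso_next_less[OF w'] by (simp add: is_cgs_def C_def del: length_append)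
  moreover have "raw_cgs p C = lasso (replicate k 1) (raw_word p w)"
  proof -
    have l: "[1..<Suc 1] = [1 :: nat]"
      by simp
    have "map (\<lambda>_. 1) [1..<Suc k] = replicate k (1 :: nat)"
      by (simp add: map_replicate_const del: upt_Suc)
    then show ?thesis
      unfolding raw_cgs_def C_def lasso_raw_word cgs.simps l product_lists_single by simp
  qed
  ultimately show ?thesis
    by (auto simp: C_def)
qed


section \<open>The reduction\<close>

text \<open>Inverse of \<open>raw_word p\<close> on words whose letters have length
  \<open>p\<close>; the guard \<open>i < length l\<close> is needed because \<open>!\<close> is
  unspecified further out.\<close>

definition word_of_raw :: "raw_word \<Rightarrow> up_word" where
  "word_of_raw w = (let f = map (\<lambda>l. {i. i < length l \<and> l ! i}) in (f (fst w), f (snd w)))"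

lemma word_of_raw:
  assumes "\<forall>l \<in> set (fst w @ snd w). length l = p"
  shows "raw_word p (word_of_raw w) = w" and "snd w \<noteq> [] \<Longrightarrow> is_up_word {..<p} (word_of_raw w)"
proof -
  have bits: "bits p {i. i < length l \<and> l ! i} = l" if "length l = p" for l
    using that by (intro nth_equalityI) (simp_all add: bits_def)
  have "map (bits p \<circ> (\<lambda>l. {i. i < length l \<and> l ! i})) ls = ls" if "set ls \<subseteq> set (fst w @ snd w)" for ls
    using that assms bits by (intro map_idI) auto
  then show "raw_word p (word_of_raw w) = w"
    by (simp add: raw_word_def word_of_raw_def Let_def)
  show "is_up_word {..<p} (word_of_raw w)" if "snd w \<noteq> []"
    using that assms by (auto simp: is_up_word_def word_of_raw_def Let_def)
qed

text \<open>Letters reach the structure unchanged, so the length condition on encoded labels carries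
  over to the letters of the input.\<close>

lemma lasso_letters:
  "fst ` snd ` set (lasso ks w) = set (fst w @ snd w)"
proof -
  have "fst ` snd ` set (lasso_from ks t i ls) = set ls" for t i ls
    by (induction ls arbitrary: i) auto
  then show ?thesis
    by (cases w) simp
qed

lemma enc_sample_up_word:
  "enc_sample enc_up_word p P N B = enc_sample (\<lambda>_. enc_raw_word) p (map (raw_word p) P) (map (raw_word p) N) B"
proof -
  have "enc_up_word p = enc_raw_word \<circ> raw_word p"
    by (rule ext) (simp add: enc_up_word_raw)
  then show ?thesis
    by (simp add: enc_sample_def)
qed

text \<open>Covers Kripke and game structures at once. \<open>sat\<close> speaks about every
  well-formed model with the encoding of a lasso, since the converse direction is handed its models;
  \<open>ex\<close> supplies models for the words of a given instance.\<close>

lemma logspace_reducible_lasso: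
  fixes ok :: "nat \<Rightarrow> 'm \<Rightarrow> bool" and raw :: "nat \<Rightarrow> 'm \<Rightarrow> raw_state list"
  assumes enc: "\<And>p m. enc p m = enc_raw_model (raw p m)"
    and letters: "\<And>p m l. l \<in> fst ` snd ` set (raw p m) \<Longrightarrow> length l = p"
    and sat: "\<And>p m w \<phi>. ok p m \<Longrightarrow> is_up_word {..<p} w \<Longrightarrow> raw p m = lasso ks (raw_word p w) \<Longrightarrow>
      atl_frag k {..<p} Ut Bt Bl \<phi> \<Longrightarrow> sat m \<phi> \<longleftrightarrow> ltl_sat (up_word_at w) (to_ltl \<phi>)"
    and ex: "\<And>p w. is_up_word {..<p} w \<Longrightarrow> \<exists>m. ok p m \<and> raw p m = lasso ks (raw_word p w)"
  shows "LTL_Learn Ut Bt Bl n \<le>\<^sub>L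
    learning_problem (\<lambda>p. atl_frag k {..<p} Ut Bt Bl) atl_size atl_bin_size sat ok enc n"
    (is "_ \<le>\<^sub>L ?L")
  unfolding logspace_reducible_def
proof (intro exI conjI allI iffI)
  let ?f = "\<lambda>x. translate (concat (map enc_num ks)) x RP 0 0"
  show "logspace_computable ?f"
    by (rule translate_logspace)
  have enc_sample: "enc_sample enc p P N B =
      enc_sample (\<lambda>_. enc_raw_model) p (map (raw p) P) (map (raw p) N) B" for p P N B
  proof -
    have "enc p = enc_raw_model \<circ> raw p"
      by (rule ext) (simp add: enc)
    then show ?thesis
      by (simp add: enc_sample_def)
  qed
  fix x
  show "?f x \<in> ?L" if yes: "x \<in> LTL_Learn Ut Bt Bl n"
  proof -
    obtain p P N B \<phi> where x: "x = enc_sample enc_up_word p P N B"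
      and ok: "\<forall>w \<in> set P \<union> set N. is_up_word {..<p} w"
      and \<phi>: "ltl_frag {..<p} Ut Bt Bl \<phi>" "ltl_size \<phi> \<le> B" "enat (ltl_bin_size \<phi>) \<le> n"
      and P: "\<forall>w \<in> set P. ltl_sat (up_word_at w) \<phi>" and N: "\<forall>w \<in> set N. \<not> ltl_sat (up_word_at w) \<phi>"
      using yes unfolding LTL_Learn_def learning_problem_def mem_Collect_eq by blast
    define g where "g w = (SOME m. ok p m \<and> raw p m = lasso ks (raw_word p w))" for w
    have g: "ok p (g w)" "raw p (g w) = lasso ks (raw_word p w)" if "is_up_word {..<p} w" for w
      using someI_ex[OF ex[OF that]] unfolding g_def by blast+
    have frag: "atl_frag k {..<p} Ut Bt Bl (of_ltl \<phi>)"
      using \<phi>(1) by (rule atl_frag_of_ltl)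
    have g_sat: "sat (g w) (of_ltl \<phi>) \<longleftrightarrow> ltl_sat (up_word_at w) \<phi>" if "is_up_word {..<p} w" for w
      using sat[OF g(1) _ g(2) frag, OF that that that] by simp
    have "?f x = enc_sample (\<lambda>_. enc_raw_model) p (map (lasso ks) (map (raw_word p) P))
        (map (lasso ks) (map (raw_word p) N)) B"
      unfolding x enc_sample_up_word
      by (rule translate_sample[OF refl]) (use ok in \<open>simp add: is_up_word_def raw_word_def ball_Un\<close>)
    also have "\<dots> = enc_sample enc p (map g P) (map g N) B"
      unfolding enc_sample map_map using ok g(2)
      by (intro arg_cong2[where f = "\<lambda>P N. enc_sample (\<lambda>_. enc_raw_model) p P N B"] map_cong) auto
    finally have fx: "?f x = enc_sample enc p (map g P) (map g N) B" .
    show ?thesis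
      unfolding learning_problem_def mem_Collect_eq
    proof (intro exI conjI)
      show "?f x = enc_sample enc p (map g P) (map g N) B"
        by (rule fx)
      show "\<forall>m \<in> set (map g P) \<union> set (map g N). ok p m"
        using ok g(1) by auto
      show "atl_frag k {..<p} Ut Bt Bl (of_ltl \<phi>)"
        by (rule frag)
      show "atl_size (of_ltl \<phi>) \<le> B" "enat (atl_bin_size (of_ltl \<phi>)) \<le> n"
        using \<phi>(2,3) by (simp_all add: atl_size_of_ltl atl_bin_size_of_ltl)
      show "\<forall>m \<in> set (map g P). sat m (of_ltl \<phi>)" "\<forall>m \<in> set (map g N). \<not> sat m (of_ltl \<phi>)"
        using ok P N g_sat by auto
    qed
  qed
  show "x \<in> LTL_Learn Ut Bt Bl n" if yes: "?f x \<in> ?L"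
  proof -
    obtain p P' N' B \<phi> where fx: "?f x = enc_sample enc p P' N' B"
      and ok: "\<forall>m \<in> set P' \<union> set N'. ok p m"
      and \<phi>: "atl_frag k {..<p} Ut Bt Bl \<phi>" "atl_size \<phi> \<le> B" "enat (atl_bin_size \<phi>) \<le> n"
      and P': "\<forall>m \<in> set P'. sat m \<phi>" and N': "\<forall>m \<in> set N'. \<not> sat m \<phi>"
      using yes unfolding learning_problem_def mem_Collect_eq by blast
    obtain P N where ne: "\<forall>w \<in> set P \<union> set N. snd w \<noteq> []"
      and x: "x = enc_sample (\<lambda>_. enc_raw_word) p P N B"
      and P: "map (raw p) P' = map (lasso ks) P" and N: "map (raw p) N' = map (lasso ks) N"
      using fx unfolding enc_sample by (rule translate_eq_sampleD)
    have word: "raw_word p (word_of_raw w) = w" "is_up_word {..<p} (word_of_raw w)"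
        "sat m \<phi> \<longleftrightarrow> ltl_sat (up_word_at (word_of_raw w)) (to_ltl \<phi>)"
      if "ok p m" "raw p m = lasso ks w" "snd w \<noteq> []" for m w
    proof -
      \<comment> \<open>The letters in \<open>raw p m\<close> have length \<open>p\<close>, and they
        are those of \<open>w\<close>: this is where inputs with letters of the wrong length are
        ruled out.\<close>
      have len: "\<forall>l \<in> set (fst w @ snd w). length l = p"
        using letters unfolding lasso_letters[of ks w, symmetric] that(2)[symmetric] by blast
      show 1: "raw_word p (word_of_raw w) = w" and 2: "is_up_word {..<p} (word_of_raw w)"
        using word_of_raw[OF len] that(3) by blast+
      show "sat m \<phi> \<longleftrightarrow> ltl_sat (up_word_at (word_of_raw w)) (to_ltl \<phi>)"
        using sat[OF that(1) 2 _ \<phi>(1)] that(2) 1 by simp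
    qed
    \<comment> \<open>Any model with the encoding of the lasso of \<open>w\<close> will do, so it is
      enough to find one in the list without comparing positions.\<close>
    have models: "\<exists>m \<in> set M. raw p m = lasso ks w" if "map (raw p) M = map (lasso ks) W" "w \<in> set W" for M W w
    proof -
      have "lasso ks w \<in> set (map (raw p) M)"
        unfolding that(1) using that(2) by simp
      then show ?thesis
        by auto
    qed
    have PN: "\<forall>w \<in> set P. \<exists>m \<in> set P'. raw p m = lasso ks w" "\<forall>w \<in> set N. \<exists>m \<in> set N'. raw p m = lasso ks w"
      using models[OF P] models[OF N] by blast+
    have words: "\<forall>w \<in> set P \<union> set N. raw_word p (word_of_raw w) = w \<and> is_up_word {..<p} (word_of_raw w)"
    proof
      fix w assume w: "w \<in> set P \<union> set N"
      then obtain m where "m \<in> set P' \<union> set N'" "raw p m = lasso ks w"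
        using PN by blast
      then show "raw_word p (word_of_raw w) = w \<and> is_up_word {..<p} (word_of_raw w)"
        using word(1,2)[of m w] ok ne w by blast
    qed
    have "map (raw_word p \<circ> word_of_raw) P = P" "map (raw_word p \<circ> word_of_raw) N = N"
      by (rule map_idI, use words in simp)+
    then have x': "x = enc_sample enc_up_word p (map word_of_raw P) (map word_of_raw N) B"
      unfolding x enc_sample_up_word map_map by simp
    show ?thesis
      unfolding LTL_Learn_def learning_problem_def mem_Collect_eq
    proof (intro exI conjI)
      show "x = enc_sample enc_up_word p (map word_of_raw P) (map word_of_raw N) B"
        by (rule x')
      show "\<forall>w \<in> set (map word_of_raw P) \<union> set (map word_of_raw N). is_up_word {..<p} w"
        unfolding set_map using words by blast
      show "ltl_frag {..<p} Ut Bt Bl (to_ltl \<phi>)"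
        using \<phi>(1) by (rule ltl_frag_to_ltl)
      show "ltl_size (to_ltl \<phi>) \<le> B"
        using ltl_size_to_ltl[of \<phi>] \<phi>(2) by (rule order_trans)
      show "enat (ltl_bin_size (to_ltl \<phi>)) \<le> n"
        by (rule order_trans[OF _ \<phi>(3)]) (simp add: ltl_bin_size_to_ltl)
      have "ltl_sat (up_word_at (word_of_raw w)) (to_ltl \<phi>)" if w: "w \<in> set P" for w
      proof -
        obtain m where "m \<in> set P'" "raw p m = lasso ks w"
          using PN(1) w by blast
        moreover from this have "ok p m" "snd w \<noteq> []"
          using ok ne w by auto
        ultimately show ?thesis
          using word(3)[of m w] P' by simp
      qed
      then show "\<forall>w \<in> set (map word_of_raw P). ltl_sat (up_word_at w) (to_ltl \<phi>)"
        by simp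
      have "\<not> ltl_sat (up_word_at (word_of_raw w)) (to_ltl \<phi>)" if w: "w \<in> set N" for w
      proof -
        obtain m where "m \<in> set N'" "raw p m = lasso ks w"
          using PN(2) w by blast
        moreover from this have "ok p m" "snd w \<noteq> []"
          using ok ne w by auto
        ultimately show ?thesis
          using word(3)[of m w] N' by simp
      qed
      then show "\<forall>w \<in> set (map word_of_raw N). \<not> ltl_sat (up_word_at w) (to_ltl \<phi>)"
        by simp
    qed
  qed
qed

theorem theorem3:
  fixes Ut :: "unop set" and Bt :: "tbinop set" and Bl :: "lbinop set" and n :: enat
  shows "LTL_Learn Ut Bt Bl n \<le>\<^sub>L CTL_Learn Ut Bt Bl n \<and>
    (\<forall>k\<ge>1. LTL_Learn Ut Bt Bl n \<le>\<^sub>L ATL_Learn k Ut Bt Bl n)"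
proof (intro conjI allI impI)
  show "LTL_Learn Ut Bt Bl n \<le>\<^sub>L CTL_Learn Ut Bt Bl n"
    unfolding CTL_Learn_def
  \<comment> \<open>The only numbers in an encoded Kripke state are its successors, so nothing
    precedes the target.\<close>
  proof (rule logspace_reducible_lasso[where raw = raw_kripke and ks = "[]"])
    show "enc_kripke p K = enc_raw_model (raw_kripke p K)" for p K
      by (rule enc_kripke_raw)
    show "length l = p" if "l \<in> fst ` snd ` set (raw_kripke p K)" for p K l
      using that by (auto simp: raw_kripke_def)
    show "\<exists>K. (is_kripke K \<and> kprops K = {..<p} \<and> (\<exists>m. kstates K = {..<m})) \<and>
        raw_kripke p K = lasso [] (raw_word p w)" if "is_up_word {..<p} w" for p w
      using that by (rule ex_lasso_kripke)
    fix p K w \<phi>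
    assume K: "is_kripke K \<and> kprops K = {..<p} \<and> (\<exists>m. kstates K = {..<m})" and w: "is_up_word {..<p} w"
      and eq: "raw_kripke p K = lasso [] (raw_word p w)" and \<phi>: "atl_frag 1 {..<p} Ut Bt Bl \<phi>"
    then obtain m where "kstates K = {..<m}"
      by blast
    with K have "is_lasso (cgs_of_kripke K) w"
      by (intro kripke_is_lasso[OF _ _ _ w eq]) simp_all
    then show "cgs_models (cgs_of_kripke K) \<phi> \<longleftrightarrow> ltl_sat (up_word_at w) (to_ltl \<phi>)"
      by (rule cgs_models_lasso[rotated]) (use w \<phi> in \<open>simp_all add: is_up_word_def cgs_of_kripke_def\<close>)
  qed
  fix k :: nat assume k: "k \<ge> 1"
  show "LTL_Learn Ut Bt Bl n \<le>\<^sub>L ATL_Learn k Ut Bt Bl n"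
    unfolding ATL_Learn_def
  \<comment> \<open>The \<open>k\<close> ones are the action counts of the agents, listed before the
    transition table.\<close>
  proof (rule logspace_reducible_lasso[where raw = raw_cgs and ks = "replicate k 1"])
    show "enc_cgs p C = enc_raw_model (raw_cgs p C)" for p C
      by (rule enc_cgs_raw)
    show "length l = p" if "l \<in> fst ` snd ` set (raw_cgs p C)" for p C l
      using that by (auto simp: raw_cgs_def simp del: upt_Suc)
    show "\<exists>C. (is_cgs C \<and> agents C = k \<and> props C = {..<p} \<and> (\<exists>m. states C = {..<m})) \<and>
        raw_cgs p C = lasso (replicate k 1) (raw_word p w)" if "is_up_word {..<p} w" for p w
      using that k by (rule ex_lasso_cgs)
    fix p C w \<phi>
    assume C: "is_cgs C \<and> agents C = k \<and> props C = {..<p} \<and> (\<exists>m. states C = {..<m})"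
      and w: "is_up_word {..<p} w"
      and eq: "raw_cgs p C = lasso (replicate k 1) (raw_word p w)" and \<phi>: "atl_frag k {..<p} Ut Bt Bl \<phi>"
    then obtain m where "states C = {..<m}"
      by blast
    with C have "is_lasso C w"
      by (intro cgs_is_lasso[OF _ _ _ _ w eq]) simp_all
    then show "cgs_models C \<phi> \<longleftrightarrow> ltl_sat (up_word_at w) (to_ltl \<phi>)"
      by (rule cgs_models_lasso[rotated]) (use C w \<phi> in \<open>simp_all add: is_up_word_def\<close>)
  qed
qed

end
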